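(* Let $d\in\mathbb{N}$ and let smoothness parameters $\beta\geq\lambda>1/2$, $r,t,\alpha\in\mathbb{R}$ be given with $\beta-\lambda\geq t\geq0$ and $\alpha+\beta-\lambda>r+t\geq0$. Let the shape parameter $$T\in\left[-\frac{r}{t},\ \min\left\{-\frac{\alpha}{\beta-\lambda},-\frac{\alpha-r}{\beta-\lambda-t}\right\}\right],$$ with $-\frac{r}{t}:=-\infty$ for $t=0$, and the refinement $N\geq1$ be given. Let $f\in\mathcal{H}^{\alpha,\beta}(\mathbb{T}^d)\cap\mathcal{C}(\mathbb{T}^d)$, let $I_N^{d,T}$ be the frequency index set with refinement $N$ and shape parameter $T$, and let $\Lambda:=\Lambda(\boldsymbol{z}_1,M_1,\ldots,\boldsymbol{z}_L,M_L)\subset\mathbb{T}^d$ be a multiple rank-1 lattice fulfilling the reconstruction property $\bigcup_{\ell=1}^L I_\ell=I$ for $I=I_N^{d,T}$. Additionally, let $L\lesssim\log|I_N^{d,T}|$ and $M:=\sum_{\ell=1}^LM_\ell\lesssim|I_N^{d,T}|\log|I_N^{d,T}|$. Then the sampling error is bounded by $$\Vert f - S^{\Lambda}_{ I_N^{d,T}} f\,|\, \mathcal{H}^{r,t}(\mathbb{T}^d) \Vert \lesssim N^{-(\alpha-r+\beta - t - \lambda)} \, (\log N) \, \Vert f\,|\, \mathcal{H}^{\alpha,\beta}(\mathbb{T}^d) \Vert$$ and $$\Vert f - S^{\Lambda}_{ I_N^{d,T}} f\,|\, \mathcal{H}^{r,t}(\mathbb{T}^d) \Vert \lesssim \Vert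 f\,|\, \mathcal{H}^{\alpha,\beta}(\mathbb{T}^d) \Vert\,(\log M)\begin{cases} \left(\frac{\log M}{M}\right)^{\frac{\alpha-r+\beta-\lambda}{d}} & \text{for } T=-\infty,\\ \left(\frac{\log M}{M}\right)^{\frac{T/d-1}{T-1}(\alpha-r+\beta - t -\lambda)} & \text{for } -\infty<T<0,\\ \left(\frac{\log^d M}{M}\right)^{\alpha - r + \beta - t -\lambda} & \text{for } T=0,\\ \left(\frac{\log M}{M}\right)^{\alpha-r+\beta - t-\lambda} & \text{for } T>0, \end{cases}$$ where the constants may depend on the dimension $d$, the smoothness parameters $r,t,\alpha,\beta,\lambda$, and the (fixed) shape parameter $T$.
   Context: Function spaces: $\mathbb{T}^d\simeq[0,1)^d$ is the $d$-dimensional torus, $\mathcal{C}(\mathbb{T}^d)$ is the space of continuous functions $\mathbb{T}^d\to\mathbb{C}$, and $\hat f_{\boldsymbol{k}}:=\int_{\mathbb{T}^d}f(\boldsymbol{x})\,\mathrm{e}^{-2\pi\mathrm{i}\boldsymbol{k}\cdot\boldsymbol{x}}\,\mathrm{d}\boldsymbol{x}$, $\boldsymbol{k}\in\mathbb{Z}^d$. The weights are $\omega^{\alpha,\beta}(\boldsymbol{k}):=\max(1,\Vert\boldsymbol{k}\Vert_1)^\alpha\prod_{s=1}^d\max(1,|k_s|)^\beta$. For $\beta\ge0$, $\alpha\ge-\beta$, $\mathcal{H}^{\alpha,\beta}(\mathbb{T}^d):=\{f\in L_1(\mathbb{T}^d):\Vert f|\mathcal{H}^{\alpha,\beta}(\mathbb{T}^d)\Vert:=(\sum_{\boldsymbol{k}\in\mathbb{Z}^d}\omega^{\alpha,\beta}(\boldsymbol{k})^2|\hat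 f_{\boldsymbol{k}}|^2)^{1/2}<\infty\}$ (dominating mixed smoothness $\beta$, isotropic smoothness $\alpha$). Index sets: for $N\ge1$ and $T\in(-\infty,1)$, $I_N^{d,T}:=\{\boldsymbol{k}\in\mathbb{Z}^d:\omega^{-T,1}(\boldsymbol{k})=\max(1,\Vert\boldsymbol{k}\Vert_1)^{-T}\prod_{s=1}^d\max(1,|k_s|)\le N^{1-T}\}$, and $I_N^{d,-\infty}:=\{\boldsymbol{k}\in\mathbb{Z}^d:\max(1,\Vert\boldsymbol{k}\Vert_1)\le N\}$. These sets are finite. Conventions for degenerate parameters: $-\frac{\alpha}{\beta-\lambda}:=-\infty$ if $\beta=\lambda$ (then $\alpha>0$), and $-\frac{\alpha-r}{\beta-\lambda-t}:=-\infty$ if $\beta-\lambda=t$ (then $\alpha-r>0$). The interval for $T$ is an interval of extended reals (it may contain $-\infty$, which happens only if $t=0$); if it is empty, nothing is asserted. Lattices: for $L\in\mathbb{N}$, $\boldsymbol{z}_\ell\in\mathbb{Z}^d$, $M_\ell\in\mathbb{N}$, the rank-1 lattice is $\Lambda(\boldsymbol{z}_\ell,M_\ell):=\{\frac{j}{M_\ell}\boldsymbol{z}_\ell\bmod\boldsymbol{1}: j=0,\ldots,M_\ell-1\}\subset\mathbb{T}^d$, and the multiple rank-1 lattice is $\Lambda(\boldsymbol{z}_1,M_1,\ldots,\boldsymbol{z}_L,M_L):=\bigcup_{\ell=1}^L\Lambda(\boldsymbol{z}_\ell,M_\ell)$. Reconstruction property: for a finite $I\subset\mathbb{Z}^d$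 let $I_\ell:=\{\boldsymbol{k}\in I:\boldsymbol{k}\cdot\boldsymbol{z}_\ell\not\equiv\boldsymbol{k}'\cdot\boldsymbol{z}_\ell\ (\mathrm{mod}\ M_\ell)\text{ for all }\boldsymbol{k}'\in I\setminus\{\boldsymbol{k}\}\}$. $\Lambda$ fulfills the reconstruction property for $I$ if $\bigcup_{\ell=1}^LI_\ell=I$. (Multiple rank-1 lattices with this property and with the assumed bounds on $L$ and $M$ can be obtained, for example, by a randomized construction with pairwise distinct prime lattice sizes $M_\ell$ and randomly chosen generating vectors $\boldsymbol{z}_\ell$, which succeeds with high probability.) Sampling operator: for $\boldsymbol{k}\in I$ let $\mathcal{L}^\Lambda_{\boldsymbol{k}}:=\{\ell\in\{1,\ldots,L\}:\boldsymbol{k}\in I_\ell\}$ (nonempty under the reconstruction property). For continuous $f$ put $\hat f_{\boldsymbol{k}}^{\Lambda(\boldsymbol{z}_\ell,M_\ell)}:=\frac1{M_\ell}\sum_{j=0}^{M_\ell-1}f(\frac{j}{M_\ell}\boldsymbol{z}_\ell\bmod\boldsymbol{1})\,\mathrm{e}^{-2\pi\mathrm{i}j\boldsymbol{k}\cdot\boldsymbol{z}_\ell/M_\ell}$, $\hat f_{\boldsymbol{k}}^\Lambda:=\frac1{|\mathcal{L}^\Lambda_{\boldsymbol{k}}|}\sum_{\ell\in\mathcal{L}^\Lambda_{\boldsymbol{k}}}\hat f_{\boldsymbol{k}}^{\Lambda(\boldsymbol{z}_\ell,M_\ell)}$, and $S_I^\Lambda f:=\sum_{\boldsymbol{k}\in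 I}\hat f_{\boldsymbol{k}}^\Lambda\,\mathrm{e}^{2\pi\mathrm{i}\boldsymbol{k}\cdot\circ}$, where $\circ$ denotes the function argument. Asymptotic notation: $a\lesssim b$ means $a\le Cb$ with a constant $C>0$ independent of $N$, $f$ and $\Lambda$. The constants in the two assumed bounds on $L$ and $M$ are fixed in advance; the constants in the conclusions may depend on them in addition to the listed parameters. $\log^dM$ means $(\log M)^d$.
   Formalization: In the first bound, log N is replaced by log max(2,N), which agrees with log N for N ≥ 2; with log N the bound fails at N = 1, where the right side is 0 but the error of an exponential with frequency outside the index set is not. *)

theory Defs
  imports "HOL-Analysis.Analysis" "HOL-Number_Theory.Cong"
begin

text \<open>
  Functions on the torus are modelled as functions on \<open>real ^ 'd\<close> that are 1-periodic in every
  coordinate; the dimension is \<open>d = CARD('d)\<close>, and frequencies live in \<open>int ^ 'd\<close>.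
\<close>

definition unit_cube :: "(real ^ 'd) set" where
  "unit_cube = {x. \<forall>s. 0 \<le> x $ s \<and> x $ s < 1}"

definition torus_function :: "(real ^ 'd \<Rightarrow> complex) \<Rightarrow> bool" where
  "torus_function f \<longleftrightarrow> (\<forall>x (n :: int ^ 'd). f (x + (\<chi> s. of_int (n $ s))) = f x)"

definition torus_continuous :: "(real ^ 'd \<Rightarrow> complex) set" where
  "torus_continuous = {f. torus_function f \<and> continuous_on UNIV f}"

definition freq_dot :: "int ^ 'd \<Rightarrow> real ^ 'd \<Rightarrow> real" where
  "freq_dot k x = (\<Sum>s\<in>UNIV. of_int (k $ s) * x $ s)"

definition int_dot :: "int ^ 'd \<Rightarrow> int ^ 'd \<Rightarrow> int" where
  "int_dot k z = (\<Sum>s\<in>UNIV. k $ s * z $ s)"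

definition fourier_coeff :: "(real ^ 'd \<Rightarrow> complex) \<Rightarrow> int ^ 'd \<Rightarrow> complex" where
  "fourier_coeff f k = (LINT x:unit_cube|lborel. f x * exp (- 2 * pi * \<i> * freq_dot k x))"

definition norm1 :: "int ^ 'd \<Rightarrow> real" where
  "norm1 k = (\<Sum>s\<in>UNIV. \<bar>of_int (k $ s)\<bar>)"

definition weight :: "real \<Rightarrow> real \<Rightarrow> int ^ 'd \<Rightarrow> real" where
  "weight a b k = max 1 (norm1 k) powr a * (\<Prod>s\<in>UNIV. max 1 \<bar>of_int (k $ s)\<bar> powr b)"

text \<open>
  \<open>hnorm\<close> has the intended value only when the series converges (\<open>infsum\<close> is \<open>0\<close> otherwise);
  convergence, i.e. finiteness of the norm, is part of membership in \<open>hspace\<close>.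
\<close>

definition hnorm :: "real \<Rightarrow> real \<Rightarrow> (real ^ 'd \<Rightarrow> complex) \<Rightarrow> real" where
  "hnorm a b f = sqrt (\<Sum>\<^sub>\<infinity>k. (weight a b k)\<^sup>2 * (cmod (fourier_coeff f k))\<^sup>2)"

definition hspace :: "real \<Rightarrow> real \<Rightarrow> (real ^ 'd \<Rightarrow> complex) set" where
  "hspace a b = {f. torus_function f \<and> set_integrable lborel unit_cube f \<and>
     (\<lambda>k. (weight a b k)\<^sup>2 * (cmod (fourier_coeff f k))\<^sup>2) summable_on UNIV}"

text \<open>The shape parameter ranges over the extended reals in \<open>[-\<infinity>, 1)\<close>.\<close>

definition index_set :: "real \<Rightarrow> ereal \<Rightarrow> (int ^ 'd) set" where
  "index_set N T =
     (if T = -\<infinity> then {k. max 1 (norm1 k) \<le> N}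
      else {k. weight (- real_of_ereal T) 1 k \<le> N powr (1 - real_of_ereal T)})"

definition neg_quot :: "real \<Rightarrow> real \<Rightarrow> ereal" where
  "neg_quot a b = (if b = 0 then -\<infinity> else ereal (- (a / b)))"

text \<open>
  A multiple rank-1 lattice is given by its data \<open>L\<close>, \<open>z 1, \<dots>, z L\<close> and \<open>M 1, \<dots>, M L\<close>; only the
  values at indices in \<open>{1..L}\<close> matter.
\<close>

definition lattice_node :: "int ^ 'd \<Rightarrow> nat \<Rightarrow> nat \<Rightarrow> real ^ 'd" where
  "lattice_node z m j = (\<chi> s. frac (real j / real m * of_int (z $ s)))"

definition recon_part :: "(int ^ 'd) set \<Rightarrow> int ^ 'd \<Rightarrow> nat \<Rightarrow> (int ^ 'd) set" where
  "recon_part I z m = {k \<in> I. \<forall>k' \<in> I - {k}. \<not> [int_dot k z = int_dot k' z] (mod int m)}"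

definition reconstruction_property ::
    "nat \<Rightarrow> (nat \<Rightarrow> int ^ 'd) \<Rightarrow> (nat \<Rightarrow> nat) \<Rightarrow> (int ^ 'd) set \<Rightarrow> bool" where
  "reconstruction_property L z M I \<longleftrightarrow> (\<Union>l\<in>{1..L}. recon_part I (z l) (M l)) = I"

definition lattice_coeff ::
    "int ^ 'd \<Rightarrow> nat \<Rightarrow> (real ^ 'd \<Rightarrow> complex) \<Rightarrow> int ^ 'd \<Rightarrow> complex" where
  "lattice_coeff z m f k = (1 / of_nat m) *
     (\<Sum>j<m. f (lattice_node z m j) * exp (- 2 * pi * \<i> * j * of_int (int_dot k z) / m))"

definition recon_indices ::
    "nat \<Rightarrow> (nat \<Rightarrow> int ^ 'd) \<Rightarrow> (nat \<Rightarrow> nat) \<Rightarrow> (int ^ 'd) set \<Rightarrow> int ^ 'd \<Rightarrow> nat set" where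
  "recon_indices L z M I k = {l \<in> {1..L}. k \<in> recon_part I (z l) (M l)}"

definition multi_coeff ::
    "nat \<Rightarrow> (nat \<Rightarrow> int ^ 'd) \<Rightarrow> (nat \<Rightarrow> nat) \<Rightarrow> (int ^ 'd) set \<Rightarrow>
     (real ^ 'd \<Rightarrow> complex) \<Rightarrow> int ^ 'd \<Rightarrow> complex" where
  "multi_coeff L z M I f k = (1 / of_nat (card (recon_indices L z M I k))) *
     (\<Sum>l\<in>recon_indices L z M I k. lattice_coeff (z l) (M l) f k)"

definition sampling_operator ::
    "nat \<Rightarrow> (nat \<Rightarrow> int ^ 'd) \<Rightarrow> (nat \<Rightarrow> nat) \<Rightarrow> (int ^ 'd) set \<Rightarrow>
     (real ^ 'd \<Rightarrow> complex) \<Rightarrow> real ^ 'd \<Rightarrow> complex" where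
  "sampling_operator L z M I f x =
     (\<Sum>k\<in>I. multi_coeff L z M I f k * exp (2 * pi * \<i> * freq_dot k x))"

end

theory Submission
  imports Defs
begin

text \<open>
  Let \<open>n k\<close> be the larger of \<open>1\<close> and the 1-norm of \<open>k\<close>, let \<open>P k\<close> be the product of the numbers
  \<open>max 1 \<bar>k\<^sub>s\<bar>\<close>, and let \<open>\<gamma> = \<alpha> - r + \<beta> - t - \<lambda>\<close>. Up to the factor \<open>d\<close>, \<open>n \<le> P\<close>, so mixed smoothness can be
  traded for isotropic smoothness, but not conversely. The interval for \<open>T\<close> is what keeps the weights
  comparable to powers of \<open>N\<close> on either side of the boundary of \<open>I\<close>: the weight with parameters
  \<open>(r, t)\<close> is at most of order \<open>N\<^sup>r\<^sup>+\<^sup>t\<close> on \<open>I\<close> (\<open>weight_inside_index_set\<close>), and the weights with parameters \<open>(\<alpha>, \<beta> - \<lambda>)\<close> and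
  \<open>(\<alpha> - r, \<beta> - \<lambda> - t)\<close> are at least of order \<open>N\<close> to the sum of the parameters off \<open>I\<close>
  (\<open>weight_outside_index_set\<close>).

  The error splits into frequencies off \<open>I\<close>, where the Fourier coefficient of the error is that of
  \<open>f\<close> and the last bound gives the factor \<open>N\<close> to the power \<open>- \<gamma>\<close>, and frequencies in \<open>I\<close>, where the
  error is aliasing. A continuous function with absolutely summable Fourier coefficients is the sum
  of its Fourier series (\<open>fourier_series_has_sum\<close>, which rests on the uniqueness theorem
  \<open>fourier_coeff_zero_imp_zero\<close>). Hence the lattice average at \<open>k\<close> is the sum of the Fourier
  coefficients at all frequencies congruent to \<open>k\<close>. If \<open>k\<close> is reconstructed by the lattice, then all
  these frequencies except \<open>k\<close> lie off \<open>I\<close>, and the classes of different reconstructed frequencies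
  are disjoint. By Cauchy-Schwarz within each class, with the weight \<open>(\<alpha>, \<beta>)\<close> factored as
  \<open>(\<alpha>, \<beta> - \<lambda>)\<close> times \<open>(0, \<lambda>)\<close>, the squared aliasing errors of one lattice add up to at most a constant
  times \<open>N\<close> to the power \<open>- 2 (\<alpha> + \<beta> - \<lambda>)\<close> times the squared norm of \<open>f\<close>; here \<open>\<lambda> > 1/2\<close> makes the
  reciprocals of the squares of the second factor summable. Averaging over the lattices loses at most
  a factor \<open>L\<close>, which is of order \<open>log N\<close>. This is \<open>sampling_error_bound\<close> and yields the first estimate.

  The second estimate rewrites \<open>N\<close> in terms of \<open>M\<close>. Residues of reconstructed frequencies are
  distinct, so \<open>\<bar>I\<bar> \<le> M\<close>, and the assumed bound on \<open>M\<close> gives that \<open>M / log M\<close> is at most of order \<open>\<bar>I\<bar>\<close>. It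
  remains to bound \<open>\<bar>I\<bar>\<close> from above by the right power of \<open>N\<close> in the four ranges of \<open>T\<close>
  (\<open>card_index_set_minf\<close>, \<open>card_index_set_neg\<close>, \<open>card_index_set_zero\<close>, \<open>card_index_set_pos\<close>).
\<close>

section \<open>Weights on the frequencies and the index sets\<close>

definition freq_size :: "int ^ 'd \<Rightarrow> real" where
  "freq_size k = max 1 (norm1 k)"

definition freq_prod :: "int ^ 'd \<Rightarrow> real" where
  "freq_prod k = (\<Prod>s\<in>UNIV. max 1 \<bar>of_int (k $ s)\<bar>)"

lemma freq_size_ge_1: "1 \<le> freq_size k"
  by (simp add: freq_size_def)

lemma freq_prod_ge_1: "1 \<le> freq_prod k"
  unfolding freq_prod_def by (rule prod_ge_1) simp

lemma freq_size_pos: "0 < freq_size k"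
  using freq_size_ge_1[of k] by simp

lemma freq_prod_pos: "0 < freq_prod k"
  using freq_prod_ge_1[of k] by simp

lemma weight_eq: "weight a b k = freq_size k powr a * freq_prod k powr b"
  unfolding weight_def freq_size_def freq_prod_def
  by (subst prod_powr_distrib) auto

lemma weight_pos: "0 < weight a b k"
  unfolding weight_eq using freq_size_pos[of k] freq_prod_pos[of k] by simp

lemma weight_add: "weight (a + a') (b + b') k = weight a b k * weight a' b' k"
  by (simp add: weight_eq powr_add)

lemma coord_le_freq_size: "max 1 \<bar>real_of_int (k $ s)\<bar> \<le> freq_size k"
proof -
  have "\<bar>real_of_int (k $ s)\<bar> \<le> norm1 k"
    unfolding norm1_def by (rule member_le_sum) auto
  thus ?thesis by (simp add: freq_size_def)
qed

lemma coord_le_freq_prod: "max 1 \<bar>real_of_int (k $ s)\<bar> \<le> freq_prod k"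
proof -
  have "freq_prod k = max 1 \<bar>real_of_int (k $ s)\<bar> * (\<Prod>s\<in>UNIV - {s}. max 1 \<bar>of_int (k $ s)\<bar>)"
    unfolding freq_prod_def by (rule prod.remove) auto
  moreover have "1 \<le> (\<Prod>s\<in>UNIV - {s}. max 1 \<bar>real_of_int (k $ s)\<bar>)"
    by (rule prod_ge_1) simp
  ultimately show ?thesis
    using mult_left_mono[of 1 "\<Prod>s\<in>UNIV - {s}. max 1 \<bar>real_of_int (k $ s)\<bar>" "max 1 \<bar>real_of_int (k $ s)\<bar>"]
    by simp
qed

lemma dim_ge_1: "1 \<le> real CARD('d::finite)"
  using zero_less_card_finite[where 'a='d] by linarith

lemma freq_size_le_coord:
  fixes k :: "int ^ 'd"
  assumes "\<And>s. max 1 \<bar>real_of_int (k $ s)\<bar> \<le> B"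
  shows "freq_size k \<le> real CARD('d) * B"
proof -
  have B: "1 \<le> B" using assms[of undefined] by simp
  have "norm1 k \<le> real CARD('d) * B"
    unfolding norm1_def using assms by (intro sum_bounded_above[of UNIV, simplified]) auto
  moreover have "1 \<le> real CARD('d) * B"
    using mult_mono[OF dim_ge_1[where 'd='d] B] by simp
  ultimately show ?thesis by (simp add: freq_size_def)
qed

text \<open>
  Every factor of the product is at least 1, so the product dominates the largest coordinate, and the
  1-norm is at most the dimension times the largest coordinate.
\<close>

lemma freq_size_le_freq_prod: "freq_size (k :: int ^ 'd) \<le> real CARD('d) * freq_prod k"
  by (rule freq_size_le_coord) (rule coord_le_freq_prod)

lemma mem_index_set_minf: "k \<in> index_set N (-\<infinity>) \<longleftrightarrow> freq_size k \<le> N"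
  by (simp add: index_set_def freq_size_def)

lemma mem_index_set_real:
  "k \<in> index_set N (ereal T) \<longleftrightarrow> freq_prod k \<le> N powr (1 - T) * freq_size k powr T"
  using freq_size_pos[of k]
  by (simp add: index_set_def weight_eq powr_minus field_simps freq_prod_pos less_imp_le)

text \<open>
  Replacing the product in the defining inequality by the smaller number \<open>freq_size k / d\<close> leaves an
  inequality between powers of \<open>freq_size k\<close> and \<open>N\<close>, in which \<open>T < 1\<close> makes the exponent positive.
\<close>

lemma index_set_size_bound:
  fixes k :: "int ^ 'd"
  assumes "k \<in> index_set N (ereal T)" "T < 1" "N \<ge> 1"
  shows "freq_size k \<le> real CARD('d) powr (1 / (1 - T)) * N"
proof -
  let ?n = "freq_size k" and ?d = "real CARD('d)"
  have n: "?n > 0" by (rule freq_size_pos)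
  have "?n \<le> ?d * (N powr (1 - T) * ?n powr T)"
    using freq_size_le_freq_prod[of k] assms(1) dim_ge_1[where 'd='d]
    by (smt (verit) mem_index_set_real mult_left_mono)
  hence "?n powr (1 - T) \<le> ?d * N powr (1 - T)"
    using n by (simp add: powr_diff field_simps)
  hence "(?n powr (1 - T)) powr (1 / (1 - T)) \<le> (?d * N powr (1 - T)) powr (1 / (1 - T))"
    using assms by (intro powr_mono2) auto
  thus ?thesis using assms n by (simp add: powr_powr powr_mult)
qed

lemma neg_quot_upper:
  assumes "ereal T \<le> neg_quot a b" "b \<ge> 0"
  shows "a + T * b \<le> 0" "b > 0"
proof -
  show b: "b > 0" using assms by (auto simp: neg_quot_def split: if_splits)
  show "a + T * b \<le> 0" using assms b by (simp add: neg_quot_def field_simps split: if_splits)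
qed

lemma neg_quot_lower:
  assumes "ereal T \<ge> neg_quot r t" "t \<ge> 0" "r + t \<ge> 0"
  shows "r + T * t \<ge> 0"
  using assms by (cases "t = 0") (simp_all add: neg_quot_def field_simps)

lemma weight_ge_freq_size_powr:
  fixes k :: "int ^ 'd"
  assumes "b \<ge> 0"
  shows "real CARD('d) powr (- b) * freq_size k powr (a + b) \<le> weight a b k"
proof -
  let ?n = "freq_size k" and ?d = "real CARD('d)"
  have d: "?d \<ge> 1" by (rule dim_ge_1)
  have "?d powr (- b) * ?n powr (a + b) = ?n powr a * (?n / ?d) powr b"
    using d freq_size_pos[of k] by (simp add: powr_add powr_divide powr_minus field_simps)
  also have "\<dots> \<le> ?n powr a * freq_prod k powr b"
    using d freq_size_pos[of k] freq_size_le_freq_prod[of k] assms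
    by (intro mult_left_mono powr_mono2) (auto simp: field_simps)
  finally show ?thesis by (simp add: weight_eq)
qed

text \<open>
  For \<open>freq_size k \<ge> N\<close> the product is replaced by \<open>freq_size k / d\<close>, which leaves the nonnegative power
  \<open>a + b\<close> of \<open>freq_size k\<close>. For \<open>freq_size k < N\<close> the failure of the defining inequality bounds the
  product from below, which leaves the power \<open>a + T b\<close>; this exponent is not positive precisely because
  \<open>T\<close> is at most \<open>- a / b\<close>.
\<close>

lemma weight_outside_index_set:
  fixes k :: "int ^ 'd"
  assumes "k \<notin> index_set N T" "T < \<infinity>" "N \<ge> 1" "b \<ge> 0" "a + b \<ge> 0" "T \<le> neg_quot a b"
  shows "real CARD('d) powr (- b) * N powr (a + b) \<le> weight a b k"
proof (cases "freq_size k \<ge> N")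
  case True
  let ?n = "freq_size k" and ?d = "real CARD('d)"
  have "?d powr (- b) * N powr (a + b) \<le> ?d powr (- b) * ?n powr (a + b)"
    using True assms by (intro mult_left_mono powr_mono2) auto
  also have "\<dots> \<le> weight a b k" using assms by (intro weight_ge_freq_size_powr)
  finally show ?thesis .
next
  case False
  let ?n = "freq_size k" and ?d = "real CARD('d)"
  have d: "?d \<ge> 1" by (rule dim_ge_1)
  have "T \<noteq> -\<infinity>" using False assms(1) by (auto simp: mem_index_set_minf)
  then obtain T' where T: "T = ereal T'" using assms(2) by (cases T) auto
  have e: "a + T' * b \<le> 0" using neg_quot_upper assms T by auto
  have n: "?n > 0" by (rule freq_size_pos)
  have "N powr (a + b) = N powr ((1 - T') * b) * N powr (a + T' * b)"
    by (simp add: powr_add[symmetric] algebra_simps)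
  also have "\<dots> \<le> N powr ((1 - T') * b) * ?n powr (a + T' * b)"
    using False e n by (intro mult_left_mono powr_mono2') auto
  also have "\<dots> = ?n powr a * (N powr (1 - T') * ?n powr T') powr b"
    using n assms by (simp add: powr_mult powr_powr powr_add)
  also have "\<dots> \<le> ?n powr a * freq_prod k powr b"
    using assms T by (intro mult_left_mono powr_mono2) (auto simp: mem_index_set_real)
  finally have "N powr (a + b) \<le> weight a b k" by (simp add: weight_eq)
  moreover have "?d powr (- b) * N powr (a + b) \<le> 1 * N powr (a + b)"
    using d assms powr_mono[of "-b" 0 ?d] by (intro mult_right_mono) auto
  ultimately show ?thesis by simp
qed

text \<open>
  Inserting the defining inequality for the product leaves the power \<open>r + T t\<close> of \<open>freq_size k\<close>; this
  exponent is nonnegative precisely because \<open>T\<close> is at least \<open>- r / t\<close>, and \<open>freq_size k\<close> is at most of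
  order \<open>N\<close>.
\<close>

lemma weight_inside_index_set:
  fixes k :: "int ^ 'd"
  assumes "k \<in> index_set N T" "T < 1" "N \<ge> 1" "t \<ge> 0" "r + t \<ge> 0" "neg_quot r t \<le> T"
  shows "weight r t k \<le> real CARD('d) powr ((r + real_of_ereal T * t) / (1 - real_of_ereal T)) * N powr (r + t)"
proof (cases T)
  case (real T')
  let ?n = "freq_size k" and ?d = "real CARD('d)"
  have T': "T' < 1" using assms real by simp
  have e: "r + T' * t \<ge> 0" using neg_quot_lower assms real by auto
  have n: "?n > 0" by (rule freq_size_pos)
  have "weight r t k = ?n powr r * freq_prod k powr t" by (rule weight_eq)
  also have "\<dots> \<le> ?n powr r * (N powr (1 - T') * ?n powr T') powr t"
    using assms real freq_prod_pos[of k] by (intro mult_left_mono powr_mono2) (auto simp: mem_index_set_real)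
  also have "\<dots> = N powr ((1 - T') * t) * ?n powr (r + T' * t)"
    using n assms by (simp add: powr_mult powr_powr powr_add)
  also have "\<dots> \<le> N powr ((1 - T') * t) * (?d powr (1 / (1 - T')) * N) powr (r + T' * t)"
    using assms real e n index_set_size_bound[of k N T'] by (intro mult_left_mono powr_mono2) auto
  also have "\<dots> = ?d powr ((r + T' * t) / (1 - T')) * N powr (r + t)"
    using assms by (simp add: powr_mult powr_powr powr_add[symmetric] algebra_simps)
  finally show ?thesis using real by simp
next
  case PInf thus ?thesis using assms by simp
next
  case MInf
  hence t: "t = 0" using assms by (simp add: neg_quot_def split: if_splits)
  have "weight r t k \<le> N powr r"
    using assms t MInf freq_size_pos[of k] freq_prod_pos[of k]
    by (simp add: weight_eq mem_index_set_minf powr_mono2)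
  moreover have "1 \<le> real CARD('d) powr r" using assms t dim_ge_1 by (intro ge_one_powr_ge_zero) auto
  hence "1 * N powr r \<le> real CARD('d) powr r * N powr r" by (intro mult_right_mono) auto
  ultimately show ?thesis using t MInf by simp
qed

section \<open>Cardinality of the index sets\<close>

text \<open>
  A sum over a box of a product of one-dimensional functions factors. This reduces all the counting
  below to one-dimensional sums.
\<close>

lemma sum_box_prod:
  fixes g :: "'d::finite \<Rightarrow> int \<Rightarrow> real" and B :: "'d \<Rightarrow> int set"
  assumes "\<And>s. finite (B s)"
  shows "(\<Sum>k | \<forall>s. k $ s \<in> B s. \<Prod>s\<in>UNIV. g s (k $ s)) = (\<Prod>s\<in>UNIV. \<Sum>j\<in>B s. g s j)"
    and "finite {k :: int ^ 'd. \<forall>s. k $ s \<in> B s}"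
proof -
  have bij: "bij_betw vec_lambda (PiE UNIV B) {k :: int ^ 'd. \<forall>s. k $ s \<in> B s}"
    by (rule bij_betw_byWitness[where f' = vec_nth]) (auto simp: PiE_UNIV_domain)
  have "(\<Prod>s\<in>UNIV. \<Sum>j\<in>B s. g s j) = (\<Sum>h\<in>PiE UNIV B. \<Prod>s\<in>UNIV. g s (h s))"
    using assms by (intro prod_sum_PiE) auto
  also have "\<dots> = (\<Sum>k | \<forall>s. k $ s \<in> B s. \<Prod>s\<in>UNIV. g s (k $ s))"
    by (subst sum.reindex_bij_betw[OF bij, symmetric]) simp
  finally show "(\<Sum>k | \<forall>s. k $ s \<in> B s. \<Prod>s\<in>UNIV. g s (k $ s)) = (\<Prod>s\<in>UNIV. \<Sum>j\<in>B s. g s j)" ..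
  have "finite (PiE UNIV B)" using assms by (intro finite_PiE) auto
  thus "finite {k :: int ^ 'd. \<forall>s. k $ s \<in> B s}"
    using bij_betw_finite[OF bij] by blast
qed

lemma sum_symmetric_interval:
  fixes g :: "real \<Rightarrow> real"
  shows "(\<Sum>j=-int K..int K. g (max 1 \<bar>real_of_int j\<bar>)) = g 1 + 2 * (\<Sum>p=1..K. g (real p))"
proof (induction K)
  case (Suc K)
  have "{-int (Suc K)..int (Suc K)} = insert (-int (Suc K)) (insert (int (Suc K)) {-int K..int K})"
    by auto
  thus ?case using Suc by (simp add: algebra_simps)
qed simp

text \<open>
  One step of the integral test: the increment of the antiderivative over \<open>[p - 1, p]\<close> is its
  derivative at an intermediate point.
\<close>

lemma powr_le_telescope:
  fixes s :: real
  assumes "p \<ge> 2" "s \<ge> 0" "s \<noteq> 1"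
  shows "real p powr (- s) \<le> (real p powr (1 - s) - (real p - 1) powr (1 - s)) / (1 - s)"
proof -
  have "\<exists>z>real p - 1. z < real p \<and> real p powr (1 - s) / (1 - s) - (real p - 1) powr (1 - s) / (1 - s)
      = (real p - (real p - 1)) * z powr (- s)"
  proof (rule MVT2)
    fix x assume "real p - 1 \<le> x" "x \<le> real p"
    hence "x > 0" using assms by auto
    hence "((\<lambda>x. x powr (1 - s)) has_real_derivative (1 - s) * x powr (1 - s - 1)) (at x)"
      by (rule has_real_derivative_powr)
    from DERIV_cdivide[OF this, of "1 - s"] assms
    show "((\<lambda>x. x powr (1 - s) / (1 - s)) has_real_derivative x powr (- s)) (at x)" by simp
  qed simp
  then obtain z where z: "z > real p - 1" "z < real p"
    and "real p powr (1 - s) / (1 - s) - (real p - 1) powr (1 - s) / (1 - s) = z powr (- s)" by auto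
  moreover have "real p powr (- s) \<le> z powr (- s)"
    using z assms by (intro powr_mono2') auto
  ultimately show ?thesis by (simp add: diff_divide_distrib)
qed

lemma sum_powr_head:
  assumes "0 \<le> s" "s < 1"
  shows "(\<Sum>p=1..J. real p powr (- s)) \<le> real J powr (1 - s) / (1 - s)"
proof (induction J)
  case (Suc J)
  show ?case
  proof (cases "J = 0")
    case False
    have "real (Suc J) powr (- s) \<le> (real (Suc J) powr (1 - s) - real J powr (1 - s)) / (1 - s)"
      using powr_le_telescope[of "Suc J" s] False assms by simp
    with Suc show ?thesis by (simp add: diff_divide_distrib)
  qed (use assms in \<open>simp add: field_simps\<close>)
qed simp

lemma sum_powr_tail:
  assumes "s > 1" "J \<ge> 1"
  shows "(\<Sum>p=J+1..K. real p powr (- s)) \<le> real J powr (1 - s) / (s - 1)"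
proof -
  have "(\<Sum>p=J+1..K. real p powr (- s)) \<le> (real J powr (1 - s) - real K powr (1 - s)) / (s - 1)"
    if "K \<ge> J"
    using that
  proof (induction K rule: dec_induct)
    case (step K)
    have "real (Suc K) powr (- s) \<le> (real (Suc K) powr (1 - s) - real K powr (1 - s)) / (1 - s)"
      using powr_le_telescope[of "Suc K" s] assms step by simp
    also have "\<dots> = (real K powr (1 - s) - real (Suc K) powr (1 - s)) / (s - 1)"
      using assms by (simp add: field_simps)
    finally show ?case using step by (simp add: diff_divide_distrib)
  qed simp
  moreover have "(real J powr (1 - s) - real K powr (1 - s)) / (s - 1) \<le> real J powr (1 - s) / (s - 1)"
    using assms by (intro divide_right_mono) auto
  ultimately show ?thesis using assms by (cases "K \<ge> J") auto
qed

lemma sum_powr_all: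
  assumes "s > 1"
  shows "(\<Sum>p=1..K. real p powr (- s)) \<le> 1 + 1 / (s - 1)"
proof (cases "K = 0")
  case False
  hence "(\<Sum>p=1..K. real p powr (- s)) = 1 + (\<Sum>p=1+1..K. real p powr (- s))"
    by (subst sum.atLeast_Suc_atMost) auto
  thus ?thesis using sum_powr_tail[of s 1 K] assms by simp
qed (use assms in simp)

lemma card_int_interval_le:
  assumes "x \<ge> 0"
  shows "finite {j::int. max 1 \<bar>real_of_int j\<bar> \<le> x}" "real (card {j::int. max 1 \<bar>real_of_int j\<bar> \<le> x}) \<le> 3 * x"
proof -
  have sub: "{j::int. max 1 \<bar>real_of_int j\<bar> \<le> x} \<subseteq> {-\<lfloor>x\<rfloor>..\<lfloor>x\<rfloor>}"
    by (auto simp: le_floor_iff abs_le_iff) (smt (verit) le_floor_iff of_int_minus)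
  thus fin: "finite {j::int. max 1 \<bar>real_of_int j\<bar> \<le> x}" using finite_subset by blast
  show "real (card {j::int. max 1 \<bar>real_of_int j\<bar> \<le> x}) \<le> 3 * x"
  proof (cases "x \<ge> 1")
    case True
    have "card {j::int. max 1 \<bar>real_of_int j\<bar> \<le> x} \<le> card {-\<lfloor>x\<rfloor>..\<lfloor>x\<rfloor>}"
      using sub by (intro card_mono) auto
    also have "\<dots> = nat (2 * \<lfloor>x\<rfloor> + 1)" by simp
    finally have "real (card {j::int. max 1 \<bar>real_of_int j\<bar> \<le> x}) \<le> real (nat (2 * \<lfloor>x\<rfloor> + 1))"
      by (rule of_nat_mono)
    also have "\<dots> \<le> 2 * x + 1" using True by (simp add: of_nat_nat le_floor_iff)
    finally show ?thesis using True by simp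
  qed (use assms in auto)
qed

lemma index_set_coord_bound:
  fixes k :: "int ^ 'd"
  assumes "k \<in> index_set N T" "T < 1" "N \<ge> 1"
  shows "max 1 \<bar>real_of_int (k $ s)\<bar> \<le> real CARD('d) powr (1 / (1 - real_of_ereal T)) * N"
proof (cases T)
  case (real T')
  thus ?thesis using index_set_size_bound[of k N T'] coord_le_freq_size[of k s] assms by simp
next
  case MInf
  have "freq_size k \<le> N" using assms MInf by (simp add: mem_index_set_minf)
  moreover have "1 * N \<le> real CARD('d) * N"
    using dim_ge_1[where 'd='d] assms by (intro mult_right_mono) auto
  ultimately have "max 1 \<bar>real_of_int (k $ s)\<bar> \<le> real CARD('d) * N"
    using coord_le_freq_size[of k s] by linarith
  thus ?thesis using MInf by simp
qed (use assms in simp)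

lemma card_box_le:
  fixes I :: "(int ^ 'd) set"
  assumes "\<And>k s. k \<in> I \<Longrightarrow> max 1 \<bar>real_of_int (k $ s)\<bar> \<le> x" "x \<ge> 0"
  shows "finite I" "real (card I) \<le> (3 * x) ^ CARD('d)"
proof -
  let ?B = "{j::int. max 1 \<bar>real_of_int j\<bar> \<le> x}"
  let ?Q = "{k :: int ^ 'd. \<forall>s. k $ s \<in> ?B}"
  have fin: "finite ?B" using card_int_interval_le assms by blast
  have finQ: "finite ?Q" using fin by (rule sum_box_prod)
  have sub: "I \<subseteq> ?Q" using assms by auto
  thus "finite I" using finQ finite_subset by blast
  have "real (card I) \<le> real (card ?Q)" using sub finQ by (intro of_nat_mono card_mono)
  also have "\<dots> = real (card ?B) ^ CARD('d)"
    using sum_box_prod(1)[of "\<lambda>_. ?B" "\<lambda>_ _. 1"] fin by simp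
  also have "\<dots> \<le> (3 * x) ^ CARD('d)"
    using card_int_interval_le assms by (intro power_mono) auto
  finally show "real (card I) \<le> (3 * x) ^ CARD('d)" .
qed

lemma
  assumes "T < 1" "N \<ge> 1"
  shows finite_index_set: "finite (index_set N T :: (int ^ 'd) set)"
    and card_index_set_poly: "real (card (index_set N T :: (int ^ 'd) set))
        \<le> (3 * (real CARD('d) powr (1 / (1 - real_of_ereal T)) * N)) ^ CARD('d)"
  using card_box_le[OF index_set_coord_bound[OF _ assms], of "index_set N T"] assms by simp_all

lemma card_index_set_minf:
  assumes "N \<ge> 1"
  shows "real (card (index_set N (-\<infinity>) :: (int ^ 'd) set)) \<le> 3 ^ CARD('d) * N ^ CARD('d)"
proof -
  have "max 1 \<bar>real_of_int (k $ s)\<bar> \<le> N" if "k \<in> index_set N (-\<infinity>)" for k :: "int ^ 'd" and s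
    using that coord_le_freq_size[of k s] by (simp add: mem_index_set_minf)
  from card_box_le(2)[OF this, of "index_set N (-\<infinity>)"] assms show ?thesis
    by (simp add: power_mult_distrib)
qed

text \<open>
  The summand is \<open>g (p / R)\<close>, where \<open>g\<close> has a singularity of order \<open>s < 1\<close> at 0 and decays with order
  \<open>s' > 1\<close>. Hence \<open>g\<close> is integrable over the half-line, and the sum is at most of order \<open>R\<close>, uniformly
  in \<open>K\<close>.
\<close>

lemma sum_two_regimes:
  assumes "0 \<le> s" "s < 1" "s' > 1" "R \<ge> 1"
  shows "(\<Sum>p=1..K. if real p \<le> R then (R / real p) powr s else (R / real p) powr s')
    \<le> (1 / (1 - s) + 2 powr (s' - 1) / (s' - 1)) * R"
proof -
  define J where "J = nat \<lfloor>R\<rfloor>"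
  have J: "J \<ge> 1" "real J \<le> R" "R < real J + 1" using assms unfolding J_def by linarith+
  have J2: "R / 2 \<le> real J" using J by linarith
  have le: "real p \<le> R \<longleftrightarrow> p \<le> J" for p using J by linarith
  let ?g = "\<lambda>p. if real p \<le> R then (R / real p) powr s else (R / real p) powr s'"
  have "(\<Sum>p=1..K. ?g p) \<le> (\<Sum>p\<in>{1..J} \<union> {J+1..K}. ?g p)"
    by (rule sum_mono2) auto
  also have "\<dots> = (\<Sum>p=1..J. ?g p) + (\<Sum>p=J+1..K. ?g p)"
    by (rule sum.union_disjoint) auto
  also have "(\<Sum>p=1..J. ?g p) = R powr s * (\<Sum>p=1..J. real p powr (- s))"
    unfolding sum_distrib_left
    by (rule sum.cong) (use assms le in \<open>auto simp: powr_divide powr_minus field_simps\<close>)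
  also have "(\<Sum>p=J+1..K. ?g p) = R powr s' * (\<Sum>p=J+1..K. real p powr (- s'))"
    unfolding sum_distrib_left
    by (rule sum.cong) (use assms le in \<open>auto simp: powr_divide powr_minus field_simps\<close>)
  also have "R powr s * (\<Sum>p=1..J. real p powr (- s)) \<le> R powr s * (R powr (1 - s) / (1 - s))"
    using sum_powr_head[of s J] assms J
    by (intro mult_left_mono order_trans[OF sum_powr_head] divide_right_mono powr_mono2) auto
  also have "R powr s' * (\<Sum>p=J+1..K. real p powr (- s')) \<le> R powr s' * ((R / 2) powr (1 - s') / (s' - 1))"
    using assms J J2
    by (intro mult_left_mono order_trans[OF sum_powr_tail] divide_right_mono powr_mono2') auto
  also have "R powr s * (R powr (1 - s) / (1 - s)) = R / (1 - s)"
    using assms by (simp add: powr_add[symmetric])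
  also have "R powr s' * ((R / 2) powr (1 - s') / (s' - 1)) = 2 powr (s' - 1) / (s' - 1) * R"
    using assms by (simp add: powr_divide powr_diff field_simps)
  finally show ?thesis by (simp add: algebra_simps)
qed

text \<open>
  Write \<open>\<tau> = - T\<close>, and choose \<open>R\<close> so that membership in the index set reads
  \<open>P n\<^sup>\<tau> \<le> R\<^sup>d\<^sup>+\<^sup>\<tau>\<close>; the claim is that there are at most of order \<open>R\<^sup>d\<close> such frequencies, as many as in the
  cube of side \<open>R\<close>. Since \<open>n\<close> dominates each coordinate, the extra factor \<open>n\<^sup>\<tau>\<close> can be shared equally
  among the \<open>d\<close> coordinates. This produces a function \<open>g\<close> of one variable, as in \<open>sum_two_regimes\<close>,
  such that the product of the values of \<open>g\<close> at the coordinates is at least 1 on the index set. Its sum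
  over all frequencies is the \<open>d\<close>-th power of a quantity of order \<open>R\<close>.
\<close>

lemma card_index_set_neg:
  assumes T: "T < 0"
  shows "\<exists>C>0. \<forall>N\<ge>1. real (card (index_set N (ereal T) :: (int ^ 'd) set))
    \<le> C * N powr ((1 - T) * real CARD('d) / (real CARD('d) - T))"
proof -
  define d where "d = real CARD('d)"
  define tau where "tau = - T"
  \<comment> \<open>Any \<open>s < 1\<close> with \<open>s (1 + \<tau> / d) > 1\<close> would do; this one makes \<open>s' = s (1 + \<tau> / d)\<close> a simple expression.\<close>
  define s where "s = (d + tau / 2) / (d + tau)"
  define s' where "s' = 1 + tau / (2 * d)"
  have d: "d \<ge> 1" unfolding d_def by (rule dim_ge_1)
  have tau: "tau > 0" using T by (simp add: tau_def)
  have s: "0 < s" "s < 1" using d tau by (auto simp: s_def field_simps)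
  have s': "s' > 1" using d tau by (simp add: s'_def field_simps)
  have ss': "s' = s + tau * s / d"
  proof -
    have "s * (d + tau) = d + tau / 2" using d tau by (simp add: s_def)
    moreover have "s + tau * s / d = s * (d + tau) / d" using d by (simp add: field_simps)
    ultimately show ?thesis using d by (simp add: s'_def field_simps)
  qed
  define A where "A = 3 * (1 / (1 - s) + 2 powr (s' - 1) / (s' - 1))"
  have A: "A > 0" using s s' unfolding A_def by (intro mult_pos_pos add_pos_pos) auto
  have "real (card (index_set N (ereal T) :: (int ^ 'd) set))
      \<le> A ^ CARD('d) * N powr ((1 - T) * d / (d - T))" if N: "N \<ge> 1" for N
  proof -
    define R where "R = N powr ((1 + tau) / (d + tau))"
    define g where "g = (\<lambda>x. if x \<le> R then (R / x) powr s else (R / x) powr s')"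
    define I where "I = (index_set N (ereal T) :: (int ^ 'd) set)"
    define c where "c = d powr (1 / (1 - T)) * N"
    define K where "K = nat \<lfloor>c\<rfloor>"
    have R: "R \<ge> 1" unfolding R_def using N d tau by (intro ge_one_powr_ge_zero) auto
    have g0: "g x \<ge> 0" for x by (simp add: g_def)
    let ?Q = "{k :: int ^ 'd. \<forall>s. k $ s \<in> {-int K..int K}}"
    have sub: "I \<subseteq> ?Q"
    proof (clarify)
      fix k s assume "k \<in> I"
      hence "\<bar>real_of_int (k $ s)\<bar> \<le> c"
        using index_set_coord_bound[of k N T s] T N by (simp add: I_def c_def d_def)
      thus "k $ s \<in> {-int K..int K}" unfolding K_def by (auto simp: abs_le_iff) linarith+
    qed
    have finQ: "finite ?Q" by (rule sum_box_prod) auto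
    have one: "1 \<le> (\<Prod>s\<in>UNIV. g (max 1 \<bar>real_of_int (k $ s)\<bar>))" if k: "k \<in> I" for k :: "int ^ 'd"
    proof -
      let ?n = "freq_size k"
      \<comment> \<open>The power of \<open>\<rho>\<close> in the bound for \<open>g\<close> is one coordinate's share of the gain from \<open>n\<^sup>\<tau>\<close>; there is a gain only if \<open>n > R\<close>.\<close>
      define \<rho> where "\<rho> = R / max ?n R"
      have n: "?n \<ge> 1" by (rule freq_size_ge_1)
      have rho: "0 < \<rho>" "\<rho> \<le> 1" using R by (auto simp: \<rho>_def)
      have le: "(R / x) powr s * \<rho> powr (tau * s / d) \<le> g x" if x: "x \<ge> 1" "x \<le> ?n" for x
      proof (cases "x \<le> R")
        case True
        have "\<rho> powr (tau * s / d) \<le> 1" using rho s tau d powr_mono2[of "tau * s / d" \<rho> 1] by simp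
        thus ?thesis using True mult_left_mono[of "\<rho> powr (tau * s / d)" 1 "(R / x) powr s"]
          by (simp add: g_def)
      next
        case False
        have "\<rho> powr (tau * s / d) \<le> (R / x) powr (tau * s / d)"
          using rho s tau d x R False by (intro powr_mono2) (auto simp: \<rho>_def frac_le)
        hence "(R / x) powr s * \<rho> powr (tau * s / d) \<le> (R / x) powr s * (R / x) powr (tau * s / d)"
          by (intro mult_left_mono) auto
        also have "\<dots> = g x" using False by (simp add: g_def ss' powr_add)
        finally show ?thesis .
      qed
      have P: "freq_prod k > 0" by (rule freq_prod_pos)
      have "1 \<le> (R powr d / freq_prod k * \<rho> powr tau)"
      proof (cases "?n \<le> R")
        case True
        have "freq_prod k \<le> (\<Prod>s\<in>(UNIV::'d set). R)"
          unfolding freq_prod_def using coord_le_freq_size[of k] True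
          by (intro prod_mono) (auto intro: order_trans)
        also have "\<dots> = R powr d" using R by (simp add: d_def powr_realpow)
        finally show ?thesis using True R P by (simp add: \<rho>_def)
      next
        case False
        have "freq_prod k \<le> N powr (1 + tau) * ?n powr (- tau)"
          using k by (simp add: I_def mem_index_set_real tau_def)
        also have "N powr (1 + tau) = R powr (d + tau)"
          using d tau by (simp add: R_def powr_powr)
        finally have "freq_prod k \<le> R powr (d + tau) * ?n powr (- tau)" .
        thus ?thesis using False R P n
          by (simp add: \<rho>_def powr_divide powr_minus powr_add field_simps)
      qed
      hence "1 powr s \<le> (R powr d / freq_prod k * \<rho> powr tau) powr s"
        using s by (intro powr_mono2) auto
      also have "\<dots> = (R powr d / freq_prod k) powr s * \<rho> powr (tau * s)"
        using P R by (subst powr_mult) (auto simp: powr_powr)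
      also have "R powr d / freq_prod k = (\<Prod>s\<in>UNIV. R / max 1 \<bar>real_of_int (k $ s)\<bar>)"
        using R unfolding freq_prod_def by (simp add: prod_dividef d_def powr_realpow)
      also have "\<dots> powr s = (\<Prod>i\<in>UNIV. (R / max 1 \<bar>real_of_int (k $ i)\<bar>) powr s)"
        by (rule prod_powr_distrib)
      also have "\<rho> powr (tau * s) = (\<Prod>i\<in>(UNIV::'d set). \<rho> powr (tau * s / d))"
        using rho d by (simp add: d_def powr_powr flip: powr_realpow)
      also have "(\<Prod>i\<in>UNIV. (R / max 1 \<bar>real_of_int (k $ i)\<bar>) powr s) * (\<Prod>i\<in>(UNIV::'d set). \<rho> powr (tau * s / d))
          \<le> (\<Prod>i\<in>UNIV. g (max 1 \<bar>real_of_int (k $ i)\<bar>))"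
      proof -
        have "0 \<le> (R / max 1 \<bar>real_of_int (k $ i)\<bar>) powr s * \<rho> powr (tau * s / d)" for i by simp
        moreover have "(R / max 1 \<bar>real_of_int (k $ i)\<bar>) powr s * \<rho> powr (tau * s / d)
            \<le> g (max 1 \<bar>real_of_int (k $ i)\<bar>)" for i
          by (rule le) (use coord_le_freq_size[of k i] in simp_all)
        ultimately have "(\<Prod>i\<in>UNIV. (R / max 1 \<bar>real_of_int (k $ i)\<bar>) powr s * \<rho> powr (tau * s / d))
            \<le> (\<Prod>i\<in>UNIV. g (max 1 \<bar>real_of_int (k $ i)\<bar>))"
          by (intro prod_mono) blast
        thus ?thesis by (simp only: prod.distrib)
      qed
      finally show ?thesis by simp
    qed
    have "real (card I) \<le> (\<Sum>k\<in>I. \<Prod>s\<in>UNIV. g (max 1 \<bar>real_of_int (k $ s)\<bar>))"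
      using sum_mono[OF one, of I] by simp
    also have "\<dots> \<le> (\<Sum>k\<in>?Q. \<Prod>s\<in>UNIV. g (max 1 \<bar>real_of_int (k $ s)\<bar>))"
      using sub finQ g0 by (intro sum_mono2 prod_nonneg) auto
    also have "\<dots> = (\<Sum>j=-int K..int K. g (max 1 \<bar>real_of_int j\<bar>)) ^ CARD('d)"
      by (subst sum_box_prod) auto
    also have "\<dots> \<le> (A * R) ^ CARD('d)"
    proof (rule power_mono)
      have K: "K \<ge> 1"
      proof -
        have "1 \<le> d powr (1 / (1 - T))" using d T by (intro ge_one_powr_ge_zero) auto
        hence "1 * 1 \<le> c" unfolding c_def using N by (intro mult_mono) auto
        thus ?thesis unfolding K_def by linarith
      qed
      have "g (real 1) \<le> (\<Sum>p=1..K. g (real p))"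
        using K g0 by (intro member_le_sum) auto
      hence "g 1 \<le> (\<Sum>p=1..K. g (real p))" by simp
      hence "(\<Sum>j=-int K..int K. g (max 1 \<bar>real_of_int j\<bar>)) \<le> 3 * (\<Sum>p=1..K. g (real p))"
        unfolding sum_symmetric_interval by simp
      moreover have "(\<Sum>p=1..K. g (real p)) \<le> A / 3 * R"
      proof -
        have "A / 3 = 1 / (1 - s) + 2 powr (s' - 1) / (s' - 1)" unfolding A_def by simp
        thus ?thesis unfolding g_def using s s' R by (simp only: sum_two_regimes less_imp_le)
      qed
      ultimately show "(\<Sum>j=-int K..int K. g (max 1 \<bar>real_of_int j\<bar>)) \<le> A * R" by linarith
    qed (auto intro: sum_nonneg g0)
    also have "\<dots> = A ^ CARD('d) * R powr d"
      using R by (simp add: power_mult_distrib d_def powr_realpow)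
    also have "R powr d = N powr ((1 - T) * d / (d - T))"
      by (simp add: R_def powr_powr tau_def)
    finally show ?thesis by (simp add: I_def)
  qed
  moreover have "A ^ CARD('d) > 0" using A by simp
  ultimately show ?thesis unfolding d_def by blast
qed

text \<open>
  Fix which coordinate is largest in absolute value, and let \<open>m\<close> be that value and \<open>q\<close> the product over
  the other coordinates. As \<open>freq_size k \<le> d m\<close>, membership forces \<open>m\<^sup>1\<^sup>-\<^sup>T q\<close> to be at most of order
  \<open>N\<^sup>1\<^sup>-\<^sup>T\<close>, so that for given other coordinates the number of choices is at most of order \<open>N\<close> times a
  negative power of \<open>q\<close>. Summing over the other \<open>d - 1\<close> coordinates gives a power of a one-dimensional
  sum, which converges as \<open>K\<close> grows if \<open>T > 0\<close> and grows logarithmically if \<open>T = 0\<close>.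
\<close>

lemma card_index_set_fibres:
  assumes T: "0 \<le> T" "T < 1" and N: "N \<ge> 1"
  defines "d \<equiv> real CARD('d)"
  defines "K \<equiv> nat \<lfloor>d powr (1 / (1 - T)) * N\<rfloor>"
  shows "real (card (index_set N (ereal T) :: (int ^ 'd) set))
    \<le> d * (3 * (d powr (T / (1 - T)) * N)) * (1 + 2 * (\<Sum>p=1..K. real p powr (- (1 / (1 - T))))) ^ (CARD('d) - 1)"
proof -
  define I where "I = (index_set N (ereal T) :: (int ^ 'd) set)"
  define a where "a = 1 / (1 - T)"
  define A where "A = d powr (T / (1 - T)) * N"
  define S where "S = 1 + 2 * (\<Sum>p=1..K. real p powr (- a))"
  have d: "d \<ge> 1" unfolding d_def by (rule dim_ge_1)
  have A: "A > 0" unfolding A_def using d N by simp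
  have finI: "finite I" unfolding I_def using finite_index_set[of "ereal T" N] T N by simp
  define J where "J = (\<lambda>s0. {k\<in>I. \<forall>s. \<bar>k $ s\<bar> \<le> \<bar>k $ s0\<bar>})"
  have "I \<subseteq> (\<Union>s0. J s0)"
  proof
    fix k assume k: "k \<in> I"
    have "Max (range (\<lambda>s. \<bar>k $ s\<bar>)) \<in> range (\<lambda>s. \<bar>k $ s\<bar>)" by (intro Max_in) auto
    then obtain s0 where "Max (range (\<lambda>s. \<bar>k $ s\<bar>)) = \<bar>k $ s0\<bar>" by (rule imageE)
    hence "\<forall>s. \<bar>k $ s\<bar> \<le> \<bar>k $ s0\<bar>" using Max_ge[of "range (\<lambda>s. \<bar>k $ s\<bar>)"] by simp
    thus "k \<in> (\<Union>s0. J s0)" using k by (auto simp: J_def)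
  qed
  hence "card I \<le> (\<Sum>s0\<in>UNIV. card (J s0))"
    using finI by (intro order_trans[OF card_mono card_UN_le]) (auto simp: J_def)
  also have "real (\<Sum>s0\<in>UNIV. card (J s0)) \<le> (\<Sum>s0\<in>(UNIV::'d set). 3 * A * S ^ (CARD('d) - 1))"
    unfolding of_nat_sum
  proof (rule sum_mono)
    fix s0 :: 'd
    \<comment> \<open>Erasing the largest coordinate keeps \<open>freq_prod\<close> equal to the product over the other coordinates.\<close>
    define \<pi> where "\<pi> = (\<lambda>k :: int ^ 'd. (\<chi> s. if s = s0 then 0 else k $ s) :: int ^ 'd)"
    have finJ: "finite (J s0)" using finI by (simp add: J_def)
    have fibre: "real (card {k\<in>J s0. \<pi> k = w}) \<le> 3 * A * freq_prod w powr (- a)" for w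
    proof -
      let ?x = "A * freq_prod w powr (- a)"
      have "inj_on (\<lambda>k. k $ s0) {k\<in>J s0. \<pi> k = w}"
        by (rule inj_onI) (auto simp: \<pi>_def vec_eq_iff split: if_splits, metis)
      moreover have "(\<lambda>k. k $ s0) ` {k\<in>J s0. \<pi> k = w} \<subseteq> {j::int. max 1 \<bar>real_of_int j\<bar> \<le> ?x}"
      proof (rule image_subsetI)
        fix k assume "k \<in> {k\<in>J s0. \<pi> k = w}"
        hence k: "k \<in> J s0" and w: "w = \<pi> k" by auto
        define m where "m = max 1 \<bar>real_of_int (k $ s0)\<bar>"
        have m: "m \<ge> 1" by (simp add: m_def)
        have "max 1 \<bar>real_of_int (k $ s)\<bar> \<le> m" for s
        proof -
          have "real_of_int \<bar>k $ s\<bar> \<le> real_of_int \<bar>k $ s0\<bar>"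
            using k unfolding J_def of_int_le_iff by blast
          thus ?thesis unfolding m_def by simp
        qed
        hence n: "freq_size k \<le> d * m" unfolding d_def by (rule freq_size_le_coord)
        have q: "freq_prod k = m * freq_prod w"
        proof -
          have "freq_prod k = m * (\<Prod>s\<in>UNIV - {s0}. max 1 \<bar>real_of_int (k $ s)\<bar>)"
            unfolding freq_prod_def m_def by (rule prod.remove) auto
          moreover have "freq_prod w = 1 * (\<Prod>s\<in>UNIV - {s0}. max 1 \<bar>real_of_int (w $ s)\<bar>)"
            unfolding freq_prod_def by (subst prod.remove[of _ s0]) (auto simp: w \<pi>_def)
          moreover have "(\<Prod>s\<in>UNIV - {s0}. max 1 \<bar>real_of_int (k $ s)\<bar>) = (\<Prod>s\<in>UNIV - {s0}. max 1 \<bar>real_of_int (w $ s)\<bar>)"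
            by (rule prod.cong) (auto simp: w \<pi>_def)
          ultimately show ?thesis by simp
        qed
        have w0: "freq_prod w > 0" by (rule freq_prod_pos)
        have "m * freq_prod w \<le> N powr (1 - T) * freq_size k powr T"
          using k q by (simp add: J_def I_def mem_index_set_real)
        also have "\<dots> \<le> N powr (1 - T) * (d * m) powr T"
          using n T freq_size_pos[of k] by (intro mult_left_mono powr_mono2) auto
        also have "\<dots> = N powr (1 - T) * d powr T * m powr T" by (simp add: powr_mult)
        finally have "m / m powr T \<le> N powr (1 - T) * d powr T / freq_prod w"
          using m w0 by (simp add: divide_simps mult_ac)
        hence "m powr (1 - T) \<le> N powr (1 - T) * d powr T * freq_prod w powr (- 1)"
          using m w0 powr_diff[of m 1 T] by (simp add: powr_minus divide_inverse)
        hence "(m powr (1 - T)) powr a \<le> (N powr (1 - T) * d powr T * freq_prod w powr (- 1)) powr a"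
          using T by (intro powr_mono2) (auto simp: a_def)
        also have "(m powr (1 - T)) powr a = m" using m T by (simp add: powr_powr a_def)
        also have "(N powr (1 - T) * d powr T * freq_prod w powr (- 1)) powr a = ?x"
        proof -
          have "(1 - T) * a = 1" "T * a = T / (1 - T)" using T by (simp_all add: a_def)
          thus ?thesis using N by (simp only: powr_mult powr_powr) (simp add: A_def mult_ac)
        qed
        finally have "m \<le> ?x" .
        thus "k $ s0 \<in> {j. max 1 \<bar>real_of_int j\<bar> \<le> ?x}" by (simp add: m_def)
      qed
      ultimately have "card {k\<in>J s0. \<pi> k = w} \<le> card {j::int. max 1 \<bar>real_of_int j\<bar> \<le> ?x}"
        using card_int_interval_le(1)[of ?x] A by (intro card_inj_on_le) auto
      thus ?thesis using card_int_interval_le(2)[of ?x] A by simp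
    qed
    define B where "B = (\<lambda>s. if s = s0 then {0} else {-int K..int K})"
    have finB: "finite (B s)" for s by (simp add: B_def)
    have sub: "\<pi> ` J s0 \<subseteq> {w. \<forall>s. w $ s \<in> B s}"
    proof clarify
      fix k s assume "k \<in> J s0"
      hence "\<bar>real_of_int (k $ s)\<bar> \<le> d powr (1 / (1 - T)) * N"
        using index_set_coord_bound[of k N T s] T N by (simp add: I_def J_def d_def)
      thus "\<pi> k $ s \<in> B s" unfolding K_def B_def \<pi>_def by (auto simp: abs_le_iff) linarith+
    qed
    have "real (card (J s0)) = (\<Sum>w\<in>\<pi> ` J s0. \<Sum>k | k \<in> J s0 \<and> \<pi> k = w. 1)"
      using sum.image_gen[OF finJ, of "\<lambda>_. 1::real" \<pi>] by simp
    also have "\<dots> \<le> (\<Sum>w\<in>\<pi> ` J s0. 3 * A * freq_prod w powr (- a))"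
      using fibre by (intro sum_mono) simp
    also have "\<dots> \<le> (\<Sum>w | \<forall>s. w $ s \<in> B s. 3 * A * freq_prod w powr (- a))"
      using sub A sum_box_prod(2)[of B] finB by (intro sum_mono2) auto
    also have "\<dots> = 3 * A * (\<Sum>w | \<forall>s. w $ s \<in> B s. \<Prod>s\<in>UNIV. max 1 \<bar>real_of_int (w $ s)\<bar> powr (- a))"
      unfolding sum_distrib_left freq_prod_def by (subst prod_powr_distrib) auto
    also have "(\<Sum>w | \<forall>s. w $ s \<in> B s. \<Prod>s\<in>UNIV. max 1 \<bar>real_of_int (w $ s)\<bar> powr (- a))
        = (\<Prod>s\<in>UNIV. \<Sum>j\<in>B s. max 1 \<bar>real_of_int j\<bar> powr (- a))"
      by (rule sum_box_prod) (rule finB)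
    also have "\<dots> = (\<Prod>s\<in>UNIV - {s0}. \<Sum>j\<in>B s. max 1 \<bar>real_of_int j\<bar> powr (- a))"
      by (subst prod.remove[of _ s0]) (auto simp: B_def)
    also have "\<dots> = (\<Prod>s\<in>UNIV - {s0}. S)"
      using sum_symmetric_interval[of "\<lambda>x. x powr (- a)" K]
      by (intro prod.cong) (auto simp: B_def S_def)
    also have "\<dots> = S ^ (CARD('d) - 1)" by simp
    finally show "real (card (J s0)) \<le> 3 * A * S ^ (CARD('d) - 1)" .
  qed
  also have "\<dots> = d * (3 * A) * S ^ (CARD('d) - 1)" by (simp add: d_def)
  finally show ?thesis unfolding I_def A_def S_def a_def by simp
qed

lemma card_index_set_pos:
  assumes T: "0 < T" "T < 1"
  shows "\<exists>C>0. \<forall>N\<ge>1. real (card (index_set N (ereal T) :: (int ^ 'd) set)) \<le> C * N"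
proof -
  let ?d = "real CARD('d)" and ?a = "1 / (1 - T)"
  define S where "S = 1 + 2 * (1 + 1 / (?a - 1))"
  have d: "?d \<ge> 1" by (rule dim_ge_1)
  have a: "?a > 1" using T by simp
  have S: "S > 0" using a unfolding S_def by (intro add_pos_nonneg mult_nonneg_nonneg add_nonneg_nonneg divide_nonneg_pos) auto
  define C where "C = ?d * (3 * ?d powr (T / (1 - T))) * S ^ (CARD('d) - 1)"
  have "real (card (index_set N (ereal T) :: (int ^ 'd) set)) \<le> C * N" if N: "N \<ge> 1" for N
  proof -
    let ?K = "nat \<lfloor>?d powr (1 / (1 - T)) * N\<rfloor>"
    have "real (card (index_set N (ereal T) :: (int ^ 'd) set))
      \<le> ?d * (3 * (?d powr (T / (1 - T)) * N)) * (1 + 2 * (\<Sum>p=1..?K. real p powr (- ?a))) ^ (CARD('d) - 1)"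
      using T N by (intro card_index_set_fibres) auto
    also have "\<dots> \<le> ?d * (3 * (?d powr (T / (1 - T)) * N)) * S ^ (CARD('d) - 1)"
      unfolding S_def using sum_powr_all[OF a] N
      by (intro mult_left_mono power_mono add_left_mono) (auto intro!: add_nonneg_nonneg sum_nonneg)
    finally show ?thesis by (simp add: C_def algebra_simps)
  qed
  moreover have "C > 0" using d S unfolding C_def by (intro mult_pos_pos) auto
  ultimately show ?thesis by blast
qed

lemma card_index_set_zero:
  "\<exists>C>0. \<forall>N\<ge>1. real (card (index_set N 0 :: (int ^ 'd) set)) \<le> C * N * ln (max 2 N) ^ (CARD('d) - 1)"
proof -
  let ?d = "real CARD('d)"
  have d: "?d \<ge> 1" by (rule dim_ge_1)
  define c where "c = (3 + 2 * ln ?d) / ln 2 + 2"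
  have c: "c > 0" unfolding c_def using d by (intro add_nonneg_pos divide_nonneg_pos) auto
  define C where "C = ?d * 3 * c ^ (CARD('d) - 1)"
  have "real (card (index_set N 0 :: (int ^ 'd) set)) \<le> C * N * ln (max 2 N) ^ (CARD('d) - 1)" if N: "N \<ge> 1" for N
  proof -
    let ?K = "nat \<lfloor>?d * N\<rfloor>" and ?l = "ln (max 2 N)"
    have dN: "?d * N \<ge> 1" using mult_mono[OF d N] by simp
    hence K: "?K \<ge> 1" "real ?K \<le> ?d * N" by linarith+
    have l: "ln 2 \<le> ?l" "ln N \<le> ?l" using N by auto
    have "(\<Sum>p=1..?K. real p powr (- 1)) = harm ?K"
      by (simp add: harm_def powr_minus)
    also have "\<dots> \<le> ln (real ?K) + 1"
      using euler_mascheroni_sequence_decreasing[of 1 ?K] K by (simp add: harm_def)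
    also have "ln (real ?K) \<le> ln ?d + ln N" 
    proof -
      have "ln (real ?K) \<le> ln (?d * N)" using K d N dN by (subst ln_le_cancel_iff) linarith+
      thus ?thesis using d N by (simp add: ln_mult)
    qed
    finally have "1 + 2 * (\<Sum>p=1..?K. real p powr (- 1)) \<le> (3 + 2 * ln ?d) / ln 2 * ln 2 + 2 * ln N" by simp
    also have "\<dots> \<le> (3 + 2 * ln ?d) / ln 2 * ?l + 2 * ?l"
      using l d by (intro add_mono mult_left_mono) auto
    also have "\<dots> = c * ?l" by (simp add: c_def algebra_simps)
    finally have S: "1 + 2 * (\<Sum>p=1..?K. real p powr (- 1)) \<le> c * ?l" .
    have "real (card (index_set N 0 :: (int ^ 'd) set))
      \<le> ?d * (3 * N) * (1 + 2 * (\<Sum>p=1..?K. real p powr (- 1))) ^ (CARD('d) - 1)"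
      using card_index_set_fibres[of 0 N, where 'd='d] N d by (simp add: zero_ereal_def)
    also have "\<dots> \<le> ?d * (3 * N) * (c * ?l) ^ (CARD('d) - 1)"
      using S N by (intro mult_left_mono power_mono) (auto intro!: add_nonneg_nonneg sum_nonneg)
    finally show ?thesis by (simp add: C_def power_mult_distrib mult_ac)
  qed
  moreover have "C > 0" using d c unfolding C_def by (intro mult_pos_pos) auto
  ultimately show ?thesis by blast
qed

section \<open>From the refinement to the number of samples\<close>

text \<open>
  The index set contains the integer multiples of one coordinate vector up to length \<open>N\<close>: on them
  \<open>freq_size\<close> and \<open>freq_prod\<close> agree.
\<close>

lemma card_index_set_lower:
  assumes N: "N \<ge> 1" and T: "T < 1"
  shows "max 3 N \<le> real (card (index_set N T :: (int ^ 'd) set))"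
proof -
  obtain s0 :: 'd where True by simp
  define n where "n = \<lfloor>N\<rfloor>"
  have n: "n \<ge> 1" "real_of_int n \<le> N" "N < real_of_int n + 1" using N unfolding n_def by linarith+
  have "axis s0 j \<in> (index_set N T :: (int ^ 'd) set)" if j: "j \<in> {-n..n}" for j
  proof -
    define m where "m = max 1 \<bar>real_of_int j\<bar>"
    have "real_of_int \<bar>j\<bar> \<le> real_of_int n" using j unfolding of_int_le_iff by auto
    hence m: "1 \<le> m" "m \<le> N" using n N by (auto simp: m_def)
    have "norm1 (axis s0 j) = (\<Sum>s\<in>UNIV. if s = s0 then \<bar>real_of_int j\<bar> else 0)"
      unfolding norm1_def by (intro sum.cong) (auto simp: axis_def)
    hence size: "freq_size (axis s0 j) = m" by (simp add: freq_size_def m_def)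
    have "freq_prod (axis s0 j) = (\<Prod>s\<in>UNIV. if s = s0 then m else 1)"
      unfolding freq_prod_def by (intro prod.cong) (auto simp: axis_def m_def)
    hence prod: "freq_prod (axis s0 j) = m" by (simp add: prod.delta)
    show ?thesis
    proof (cases T)
      case (real T')
      have "m powr (1 - T') \<le> N powr (1 - T')" using m T real by (intro powr_mono2) auto
      hence "m powr (1 - T') * m powr T' \<le> N powr (1 - T') * m powr T'" by (intro mult_right_mono) auto
      thus ?thesis using m unfolding real mem_index_set_real size prod by (simp add: powr_add[symmetric])
    qed (use T m size in \<open>auto simp: mem_index_set_minf\<close>)
  qed
  hence "(\<lambda>j. axis s0 j) ` {-n..n} \<subseteq> (index_set N T :: (int ^ 'd) set)" by auto
  moreover have "inj_on (\<lambda>j. axis s0 j :: int ^ 'd) {-n..n}"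
    by (rule inj_onI) (metis axis_nth)
  ultimately have "card {-n..n} \<le> card (index_set N T :: (int ^ 'd) set)"
    using finite_index_set[OF T N] by (intro card_inj_on_le)
  hence "real_of_int (2 * n + 1) \<le> real (card (index_set N T :: (int ^ 'd) set))"
    using n by simp
  thus ?thesis using n by simp
qed

lemma ln_card_index_set:
  assumes T: "T < 1"
  shows "\<exists>B>0. \<forall>N\<ge>1. ln (real (card (index_set N T :: (int ^ 'd) set))) \<le> B * ln (max 2 N)"
proof -
  let ?d = "real CARD('d)"
  define c where "c = 3 * ?d powr (1 / (1 - real_of_ereal T))"
  have d: "?d \<ge> 1" by (rule dim_ge_1)
  have c: "c > 1"
  proof -
    have "real_of_ereal T < 1" using T by (cases T) auto
    hence "1 \<le> ?d powr (1 / (1 - real_of_ereal T))" using d by (intro ge_one_powr_ge_zero) auto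
    thus ?thesis by (simp add: c_def)
  qed
  define B where "B = ?d * (ln c / ln 2 + 1)"
  have "ln (real (card (index_set N T :: (int ^ 'd) set))) \<le> B * ln (max 2 N)" if N: "N \<ge> 1" for N
  proof -
    let ?I = "index_set N T :: (int ^ 'd) set" and ?l = "ln (max 2 N)"
    have l: "ln 2 \<le> ?l" "ln N \<le> ?l" using N by auto
    have "real (card ?I) \<le> (c * N) ^ CARD('d)"
      using card_index_set_poly[OF T N, where 'd='d] by (simp add: c_def mult.assoc)
    hence "ln (real (card ?I)) \<le> ln ((c * N) ^ CARD('d))"
      using card_index_set_lower[OF N T, where 'd='d] c N by (subst ln_le_cancel_iff) auto
    also have "\<dots> = ?d * (ln c + ln N)" using c N by (simp add: ln_realpow ln_mult)
    also have "\<dots> \<le> ?d * (ln c / ln 2 * ?l + ?l)"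
    proof -
      have "ln c / ln 2 * ln 2 \<le> ln c / ln 2 * ?l" using c l by (intro mult_left_mono) auto
      hence "ln c + ln N \<le> ln c / ln 2 * ?l + ?l" using l by simp
      thus ?thesis using d by (intro mult_left_mono) auto
    qed
    finally show ?thesis by (simp add: B_def algebra_simps)
  qed
  moreover have "B > 0" unfolding B_def using c d by (intro mult_pos_pos add_nonneg_pos divide_nonneg_pos) auto
  ultimately show ?thesis by blast
qed

text \<open>
  Reconstructed frequencies have pairwise different residues modulo the lattice size.
\<close>

lemma card_recon_part_le:
  assumes "m \<ge> 1"
  shows "card (recon_part I z m) \<le> m"
proof -
  have "inj_on (\<lambda>k. int_dot k z mod int m) (recon_part I z m)"
  proof (rule inj_onI, rule ccontr)
    fix k k' assume k: "k \<in> recon_part I z m" "k' \<in> recon_part I z m" "k \<noteq> k'"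
      and e: "int_dot k z mod int m = int_dot k' z mod int m"
    have "\<not> [int_dot k z = int_dot k' z] (mod int m)" using k unfolding recon_part_def by blast
    thus False using e by (simp add: cong_def)
  qed
  moreover have "(\<lambda>k. int_dot k z mod int m) ` recon_part I z m \<subseteq> {0..<int m}" using assms by auto
  ultimately have "card (recon_part I z m) \<le> card {0..<int m}" by (intro card_inj_on_le) auto
  thus ?thesis by simp
qed

lemma reconstruction_card_le:
  assumes "reconstruction_property L z m I" "\<forall>l\<in>{1..L}. m l \<ge> 1"
  shows "card I \<le> (\<Sum>l=1..L. m l)"
proof -
  have "card I = card (\<Union>l\<in>{1..L}. recon_part I (z l) (m l))"
    using assms by (simp only: reconstruction_property_def)
  also have "\<dots> \<le> (\<Sum>l=1..L. card (recon_part I (z l) (m l)))" by (rule card_UN_le) simp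
  also have "\<dots> \<le> (\<Sum>l=1..L. m l)" using assms by (intro sum_mono card_recon_part_le) auto
  finally show ?thesis .
qed

lemma powr_rate:
  fixes N :: real
  assumes "Y > 0" "C > 0" "Y \<le> C * N" "\<gamma> \<ge> 0" "N > 0"
  shows "N powr (- \<gamma>) \<le> C powr \<gamma> * (1 / Y) powr \<gamma>"
proof -
  have "N powr (- \<gamma>) \<le> (Y / C) powr (- \<gamma>)"
    using assms by (intro powr_mono2') (auto simp: field_simps)
  also have "\<dots> = C powr \<gamma> * (1 / Y) powr \<gamma>"
    using assms by (simp add: powr_divide powr_minus field_simps)
  finally show ?thesis .
qed

text \<open>
  From \<open>3 \<le> \<bar>I\<bar> \<le> M\<close> and the assumed bound on \<open>M\<close> it follows that \<open>M / log M\<close> is at most of order \<open>\<bar>I\<bar>\<close>.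
  Unless \<open>T = 0\<close>, the cardinality is of order \<open>N\<^sup>e\<close> for some \<open>e > 0\<close>, and the exponent in the rate is
  \<open>\<gamma> / e\<close>. For \<open>T = 0\<close> the cardinality carries \<open>d - 1\<close> further logarithms, which are absorbed
  into \<open>(log M)\<^sup>d\<close> because \<open>N \<le> M\<close>.
\<close>

lemma rate_in_samples:
  assumes T: "T < 1" and \<gamma>: "\<gamma> \<ge> 0" and CM: "C\<^sub>M > 0"
  defines "d \<equiv> real CARD('d)"
  shows "\<exists>C>0. \<forall>N M. N \<ge> 1 \<longrightarrow> real (card (index_set N T :: (int ^ 'd) set)) \<le> M \<longrightarrow>
    M \<le> C\<^sub>M * (real (card (index_set N T :: (int ^ 'd) set)) * ln (real (card (index_set N T :: (int ^ 'd) set)))) \<longrightarrow>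
    N powr (- \<gamma>) \<le> C *
      (if T = -\<infinity> then (ln M / M) powr (\<gamma> / d)
       else if T < 0 then (ln M / M) powr ((real_of_ereal T / d - 1) / (real_of_ereal T - 1) * \<gamma>)
       else if T = 0 then (ln M ^ CARD('d) / M) powr \<gamma>
       else (ln M / M) powr \<gamma>)"
proof -
  have d: "d \<ge> 1" unfolding d_def by (rule dim_ge_1)
  let ?I = "\<lambda>N. index_set N T :: (int ^ 'd) set"
  have big: "3 \<le> M" "N \<le> M" "1 \<le> ln M" "ln (real (card (?I N))) \<le> ln M" "ln (max 2 N) \<le> ln M"
    if N: "N \<ge> 1" and M: "real (card (?I N)) \<le> M" for N M
  proof -
    have c: "max 3 N \<le> real (card (?I N))" by (rule card_index_set_lower[OF N T])
    thus 3: "3 \<le> M" "N \<le> M" using M by auto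
    show "ln (real (card (?I N))) \<le> ln M" using c M by (subst ln_le_cancel_iff) auto
    show "ln (max 2 N) \<le> ln M" using 3 N by (subst ln_le_cancel_iff) auto
    have "exp 1 \<le> M" using exp_le 3 by linarith
    thus "1 \<le> ln M" using 3 by (subst ln_ge_iff) auto
  qed
  have base: "M / ln M \<le> C\<^sub>M * real (card (?I N))"
    if N: "N \<ge> 1" and M: "real (card (?I N)) \<le> M" "M \<le> C\<^sub>M * (real (card (?I N)) * ln (real (card (?I N))))" for N M
  proof -
    note M(2)
    also have "C\<^sub>M * (real (card (?I N)) * ln (real (card (?I N)))) \<le> C\<^sub>M * (real (card (?I N)) * ln M)"
      using big[OF N M(1)] CM by (intro mult_left_mono) auto
    finally show ?thesis using big[OF N M(1)] by (simp add: field_simps)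
  qed
  \<comment> \<open>The three cases in which the cardinality is at most a pure power of \<open>N\<close>.\<close>
  have power_rate: ?thesis
    if C: "C > 0" "\<And>N. N \<ge> 1 \<Longrightarrow> real (card (?I N)) \<le> C * N powr e" and e: "e > 0"
      and rate: "\<And>M. (if T = -\<infinity> then (ln M / M) powr (\<gamma> / d)
       else if T < 0 then (ln M / M) powr ((real_of_ereal T / d - 1) / (real_of_ereal T - 1) * \<gamma>)
       else if T = 0 then (ln M ^ CARD('d) / M) powr \<gamma>
       else (ln M / M) powr \<gamma>) = (ln M / M) powr (1 / e * \<gamma>)" for C e
  proof (intro exI[of _ "((C\<^sub>M * C) powr (1 / e)) powr \<gamma>"] conjI allI impI)
    show "((C\<^sub>M * C) powr (1 / e)) powr \<gamma> > 0" using C CM by simp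
    fix N M :: real
    assume N: "N \<ge> 1" and M: "real (card (?I N)) \<le> M"
      "M \<le> C\<^sub>M * (real (card (?I N)) * ln (real (card (?I N))))"
    define Y where "Y = (M / ln M) powr (1 / e)"
    have pos: "M > 0" "ln M > 0" using big[OF N M(1)] by auto
    have "M / ln M \<le> C\<^sub>M * (C * N powr e)"
      using base[OF N M] C(2)[OF N] CM by (meson mult_left_mono less_imp_le order_trans)
    hence "Y \<le> (C\<^sub>M * C * N powr e) powr (1 / e)"
      unfolding Y_def using pos e by (intro powr_mono2) (auto simp: mult_ac)
    also have "\<dots> = (C\<^sub>M * C) powr (1 / e) * N" using e N by (subst powr_mult) (simp add: powr_powr)
    finally have "N powr (- \<gamma>) \<le> ((C\<^sub>M * C) powr (1 / e)) powr \<gamma> * (1 / Y) powr \<gamma>"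
      using pos N C CM \<gamma> by (intro powr_rate) (auto simp: Y_def)
    also have "(1 / Y) powr \<gamma> = (ln M / M) powr (1 / e * \<gamma>)"
    proof -
      have "1 / Y = (ln M / M) powr (1 / e)" using pos by (simp add: Y_def powr_divide)
      thus ?thesis by (simp add: powr_powr)
    qed
    finally show "N powr (- \<gamma>) \<le> ((C\<^sub>M * C) powr (1 / e)) powr \<gamma> *
      (if T = -\<infinity> then (ln M / M) powr (\<gamma> / d)
       else if T < 0 then (ln M / M) powr ((real_of_ereal T / d - 1) / (real_of_ereal T - 1) * \<gamma>)
       else if T = 0 then (ln M ^ CARD('d) / M) powr \<gamma>
       else (ln M / M) powr \<gamma>)" unfolding rate .
  qed
  show ?thesis
  proof (cases T)
    case (real T')
    consider "T' < 0" | "T' = 0" | "T' > 0" by linarith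
    thus ?thesis
    proof cases
      case 1
      then obtain C where "C > 0" "\<And>N. N \<ge> 1 \<Longrightarrow> real (card (?I N)) \<le> C * N powr ((1 - T') * d / (d - T'))"
        using card_index_set_neg[of T', where 'd='d] real unfolding d_def by auto
      thus ?thesis
      proof (rule power_rate)
        show "0 < (1 - T') * d / (d - T')" using 1 d by (intro divide_pos_pos mult_pos_pos) auto
        have "1 / ((1 - T') * d / (d - T')) = (T' / d - 1) / (T' - 1)" using 1 d by (simp add: divide_simps) (simp add: algebra_simps)
        thus "(if T = -\<infinity> then (ln M / M) powr (\<gamma> / d)
          else if T < 0 then (ln M / M) powr ((real_of_ereal T / d - 1) / (real_of_ereal T - 1) * \<gamma>)
          else if T = 0 then (ln M ^ CARD('d) / M) powr \<gamma>
          else (ln M / M) powr \<gamma>) = (ln M / M) powr (1 / ((1 - T') * d / (d - T')) * \<gamma>)" for M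
          using 1 real by simp
      qed
    next
      case 3
      then obtain C where "C > 0" "\<And>N. N \<ge> 1 \<Longrightarrow> real (card (?I N)) \<le> C * N powr 1"
        using card_index_set_pos[of T', where 'd='d] real T by auto
      thus ?thesis by (rule power_rate) (use 3 real in auto)
    next
      case 2
      hence T0: "T = 0" using real by simp
      obtain C where C: "C > 0" "\<And>N. N \<ge> 1 \<Longrightarrow> real (card (?I N)) \<le> C * N * ln (max 2 N) ^ (CARD('d) - 1)"
        using card_index_set_zero[where 'd='d] T0 by auto
      show ?thesis
      proof (intro exI[of _ "(C\<^sub>M * C) powr \<gamma>"] conjI allI impI)
        show "(C\<^sub>M * C) powr \<gamma> > 0" using C CM by simp
        fix N M :: real
        assume N: "N \<ge> 1" and M: "real (card (?I N)) \<le> M"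
          "M \<le> C\<^sub>M * (real (card (?I N)) * ln (real (card (?I N))))"
        note b = big[OF N M(1)]
        have l0: "ln (max 2 N) \<ge> 0" using N by simp
        have "M / ln M \<le> C\<^sub>M * (C * N * ln (max 2 N) ^ (CARD('d) - 1))"
          using base[OF N M] C(2)[OF N] CM by (meson mult_left_mono less_imp_le order_trans)
        also have "\<dots> \<le> C\<^sub>M * (C * N * ln M ^ (CARD('d) - 1))"
          using b l0 C N CM by (intro mult_left_mono power_mono) auto
        finally have "M \<le> C\<^sub>M * C * N * (ln M ^ (CARD('d) - 1) * ln M)" using b by (simp add: field_simps)
        also have "ln M ^ (CARD('d) - 1) * ln M = ln M ^ CARD('d)"
          by (rule power_minus_mult) (rule zero_less_card_finite)
        finally have "M / ln M ^ CARD('d) \<le> C\<^sub>M * C * N" using b by (simp add: divide_le_eq)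
        hence "N powr (- \<gamma>) \<le> (C\<^sub>M * C) powr \<gamma> * (1 / (M / ln M ^ CARD('d))) powr \<gamma>"
          using b N C CM \<gamma> by (intro powr_rate) auto
        thus "N powr (- \<gamma>) \<le> (C\<^sub>M * C) powr \<gamma> *
          (if T = -\<infinity> then (ln M / M) powr (\<gamma> / d)
           else if T < 0 then (ln M / M) powr ((real_of_ereal T / d - 1) / (real_of_ereal T - 1) * \<gamma>)
           else if T = 0 then (ln M ^ CARD('d) / M) powr \<gamma>
           else (ln M / M) powr \<gamma>)" using T0 by simp
      qed
    qed
  next
    case MInf
    have "real (card (?I N)) \<le> 3 ^ CARD('d) * N powr d" if "N \<ge> 1" for N
      using card_index_set_minf[OF that, where 'd='d] that MInf by (simp add: d_def powr_realpow)
    thus ?thesis by (rule power_rate[rotated]) (use MInf d in auto)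
  qed (use T in simp)
qed

section \<open>Characters of the torus and their orthogonality\<close>

definition torus_char :: "int ^ 'd \<Rightarrow> real ^ 'd \<Rightarrow> complex" where
  "torus_char k x = cis (2 * pi * freq_dot k x)"

lemma exp_eq_torus_char: "exp (2 * pi * \<i> * freq_dot k x) = torus_char k x"
  by (simp add: torus_char_def cis_conv_exp mult_ac)

lemma freq_dot_add_left: "freq_dot (h + k) x = freq_dot h x + freq_dot k x"
  by (simp add: freq_dot_def algebra_simps sum.distrib)

lemma freq_dot_minus_left: "freq_dot (- k) x = - freq_dot k x"
  by (simp add: freq_dot_def sum_negf)

lemma freq_dot_add_right: "freq_dot k (x + y) = freq_dot k x + freq_dot k y"
  by (simp add: freq_dot_def algebra_simps sum.distrib)

lemma torus_char_add: "torus_char (h + k) x = torus_char h x * torus_char k x"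
  by (simp add: torus_char_def freq_dot_add_left cis_mult algebra_simps)

lemma torus_char_0 [simp]: "torus_char 0 x = 1"
  by (simp add: torus_char_def freq_dot_def)

lemma norm_torus_char [simp]: "norm (torus_char k x) = 1"
  by (simp add: torus_char_def)

lemma continuous_on_torus_char [continuous_intros]: "continuous_on A (torus_char k)"
proof -
  have "continuous_on A (freq_dot k)"
    unfolding freq_dot_def by (intro continuous_intros)
  thus ?thesis unfolding torus_char_def cis_conv_exp by (intro continuous_intros)
qed

lemma exp_minus_eq_torus_char: "exp (- 2 * pi * \<i> * freq_dot k x) = torus_char (- k) x"
  by (simp add: torus_char_def cis_conv_exp freq_dot_minus_left mult_ac)

lemma fourier_coeff_eq: "fourier_coeff f k = (LINT x:unit_cube|lborel. f x * torus_char (- k) x)"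
  unfolding fourier_coeff_def by (simp only: exp_minus_eq_torus_char)

text \<open>
  Periodic functions depend only on the images of the coordinates on the unit circle. Used wherever
  a representative modulo 1 is exchanged for another.
\<close>

lemma torus_function_cong:
  assumes f: "torus_function f" and "\<And>s. cis (2 * pi * x $ s) = cis (2 * pi * y $ s)"
  shows "f x = f y"
proof -
  have "\<exists>n::int. x $ s = y $ s + of_int n" for s
  proof -
    have "sin (2 * pi * x $ s) = sin (2 * pi * y $ s) \<and> cos (2 * pi * x $ s) = cos (2 * pi * y $ s)"
      using assms(2)[of s] by (simp add: complex_eq_iff)
    then obtain n :: int where "2 * pi * x $ s = 2 * pi * y $ s + 2 * pi * n"
      unfolding sin_cos_eq_iff by (auto simp: mult_ac)
    hence "2 * pi * x $ s = 2 * pi * (y $ s + n)" by (simp add: algebra_simps)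
    thus ?thesis by auto
  qed
  then obtain n :: "'a \<Rightarrow> int" where "\<And>s. x $ s = y $ s + of_int (n s)" by metis
  hence "x = y + (\<chi> s. of_int ((\<chi> s. n s) $ s))" by (simp add: vec_eq_iff)
  thus ?thesis using f unfolding torus_function_def by metis
qed

lemma torus_function_torus_char: "torus_function (torus_char k)"
  unfolding torus_function_def
proof (intro allI)
  fix x :: "real ^ 'a" and n :: "int ^ 'a"
  have "freq_dot k (\<chi> s. of_int (n $ s)) = of_int (\<Sum>s\<in>UNIV. k $ s * n $ s)"
    by (simp add: freq_dot_def)
  thus "torus_char k (x + (\<chi> s. of_int (n $ s))) = torus_char k x"
    using cis_multiple_2pi[of "\<Sum>s\<in>UNIV. k $ s * n $ s"]
    by (simp add: torus_char_def freq_dot_add_right ring_distribs flip: cis_mult del: of_int_sum)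
qed

lemma cube_eq: "cbox 0 (1 :: real ^ 'd) = {x. \<forall>s. 0 \<le> x $ s \<and> x $ s \<le> 1}"
  by (auto simp: mem_box_cart)

lemma unit_cube_subset: "unit_cube \<subseteq> cbox 0 (1 :: real ^ 'd)"
  by (auto simp: unit_cube_def cube_eq less_imp_le)

lemma unit_cube_borel [measurable]: "(unit_cube :: (real ^ 'd) set) \<in> sets borel"
proof -
  have eq: "(unit_cube :: (real ^ 'd) set) = (\<Inter>s. {x. 0 \<le> x $ s} \<inter> {x. x $ s < 1})"
    by (auto simp: unit_cube_def)
  have "closed {x :: real ^ 'd. 0 \<le> x $ s}" "open {x :: real ^ 'd. x $ s < 1}" for s
    by (intro closed_Collect_le open_Collect_less continuous_intros)+
  thus ?thesis unfolding eq by (intro sets.finite_INT sets.Int borel_closed borel_open) auto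
qed

lemma set_integrable_unit_cube:
  fixes g :: "real ^ 'd \<Rightarrow> complex"
  assumes "continuous_on UNIV g"
  shows "set_integrable lborel unit_cube g"
proof -
  have "set_integrable lborel (cbox 0 1) g"
    unfolding set_integrable_def
    by (intro borel_integrable_compact) (auto intro: continuous_on_subset[OF assms])
  thus ?thesis by (rule set_integrable_subset) (use unit_cube_subset in auto)
qed

text \<open>
  The Fourier coefficients integrate over the half-open cube. For continuous integrands the missing
  faces are negligible, and on the closed, hence compact, cube integrability and uniform bounds are
  immediate.
\<close>

lemma unit_cube_integral:
  fixes g :: "real ^ 'd \<Rightarrow> complex"
  assumes "continuous_on UNIV g"
  shows "(LINT x:unit_cube|lborel. g x) = integral (cbox 0 1) g"
proof -
  have "(LINT x:unit_cube|lborel. g x) = integral unit_cube g"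
    by (rule set_borel_integral_eq_integral(2)) (rule set_integrable_unit_cube[OF assms])
  also have "\<dots> = integral (cbox 0 1) g"
  proof (rule integral_spike_set)
    have "cbox 0 (1 :: real ^ 'd) - unit_cube \<subseteq> cbox 0 1 - box 0 1"
      by (auto simp: unit_cube_def mem_box_cart less_imp_le)
    hence "negligible (cbox 0 (1 :: real ^ 'd) - unit_cube)"
      using negligible_frontier_interval negligible_subset by blast
    thus "negligible {x \<in> cbox 0 1 - unit_cube. g x \<noteq> 0}" by (rule negligible_subset) auto
    have "{x \<in> unit_cube - cbox 0 1. g x \<noteq> 0} = {}" using unit_cube_subset by blast
    thus "negligible {x \<in> unit_cube - cbox 0 1. g x \<noteq> 0}" by (simp only: negligible_empty)
  qed
  finally show ?thesis .
qed

lemma integral_character_unit_interval: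
  "(\<integral>y. indicator {0..<1} y *\<^sub>R cis (2 * pi * (of_int m * y)) \<partial>lborel) = (if m = 0 then 1 else 0)"
proof -
  let ?f = "\<lambda>y :: real. cis (2 * pi * (of_int m * y))"
  have cont: "continuous_on A ?f" for A unfolding cis_conv_exp by (intro continuous_intros)
  have "set_integrable lborel {0..1} ?f"
    unfolding set_integrable_def by (intro borel_integrable_compact cont) auto
  hence int: "set_integrable lborel {0..<1} ?f"
    by (rule set_integrable_subset) auto
  have "(LINT y:{0..<1}|lborel. ?f y) = integral {0..<1} ?f"
    by (rule set_borel_integral_eq_integral(2)[OF int])
  also have "\<dots> = integral {0..1} ?f"
  proof (rule integral_spike_set)
    have "{y \<in> {0..1} - {0..<1}. ?f y \<noteq> 0} \<subseteq> {1}" by auto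
    thus "negligible {y \<in> {0..1} - {0..<1}. ?f y \<noteq> 0}" using negligible_subset by blast
    have "{y \<in> {0..<1} - {0..1}. ?f y \<noteq> 0} = {}" by auto
    thus "negligible {y \<in> {0..<1} - {0..1}. ?f y \<noteq> 0}" by (simp only: negligible_empty)
  qed
  also have "\<dots> = (if m = 0 then 1 else 0)"
  proof (cases "m = 0")
    case False
    define c where "c = 2 * pi * \<i> * of_int m"
    have c: "c \<noteq> 0" using False by (simp add: c_def)
    have f: "?f = (\<lambda>y. exp (c * of_real y))" by (auto simp: cis_conv_exp c_def mult_ac)
    have "((\<lambda>y. exp (c * of_real y)) has_integral (exp (c * of_real 1) / c - exp (c * of_real 0) / c)) {0..1}"
    proof (rule fundamental_theorem_of_calculus)
      fix y :: real
      have "((\<lambda>w. exp (c * w) / c) has_field_derivative exp (c * of_real y)) (at (of_real y))"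
        using c by (auto intro!: derivative_eq_intros)
      from has_vector_derivative_real_field[OF this]
      show "((\<lambda>y. exp (c * of_real y) / c) has_vector_derivative exp (c * of_real y)) (at y within {0..1})"
        by (simp add: has_vector_derivative_at_within)
    qed simp
    moreover have "exp c = 1"
      using cis_multiple_2pi[of m] by (simp add: c_def cis_conv_exp mult_ac)
    ultimately have "((\<lambda>y. exp (c * of_real y)) has_integral 0) {0..1}" by simp
    thus ?thesis using False f by (simp add: integral_unique)
  qed (simp add: cis_zero)
  finally show ?thesis unfolding set_lebesgue_integral_def .
qed

text \<open>
  The character and the indicator of the cube are products of functions of the single coordinates,
  and Lebesgue measure is the image of a product measure, so the integral is a product of integrals
  over the unit interval.
\<close>

lemma integral_torus_char:
  "integral (cbox 0 1) (torus_char k) = (if k = (0 :: int ^ 'd) then 1 else 0)"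
proof -
  define k' :: "real ^ 'd" where "k' = (\<chi> s. of_int (k $ s))"
  define F where "F = (\<lambda>(b :: real ^ 'd) (y :: real). indicator {0..<1} y *\<^sub>R cis (2 * pi * ((k' \<bullet> b) * y)))"
  have basis: "\<exists>s. b = axis s 1" if "b \<in> Basis" for b :: "real ^ 'd"
    using that by (auto simp: Basis_vec_def)
  have int: "integrable lborel (F b)" if "b \<in> Basis" for b
  proof -
    have "integrable lborel (\<lambda>y. indicator {0..<1} y *\<^sub>R (indicator {0..1} y *\<^sub>R cis (2 * pi * ((k' \<bullet> b) * y))))"
    proof (rule integrable_mult_indicator)
      show "integrable lborel (\<lambda>y. indicator {0..1} y *\<^sub>R cis (2 * pi * ((k' \<bullet> b) * y)))"
        unfolding cis_conv_exp by (intro borel_integrable_compact continuous_intros) auto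
    qed auto
    also have "(\<lambda>y. indicator {0..<1} y *\<^sub>R (indicator {0..1} y *\<^sub>R cis (2 * pi * ((k' \<bullet> b) * y)))) = F b"
      by (auto simp: F_def fun_eq_iff indicator_def)
    finally show ?thesis .
  qed
  have prod: "indicator unit_cube x *\<^sub>R torus_char k x = (\<Prod>b\<in>Basis. F b (x \<bullet> b))" for x
  proof -
    have "x \<in> unit_cube \<longleftrightarrow> (\<forall>b\<in>Basis. x \<bullet> b \<in> {0..<1})"
      by (auto simp: unit_cube_def Basis_vec_def inner_axis)
    hence ind: "indicator unit_cube x = (\<Prod>b\<in>Basis. indicator {0..<1} (x \<bullet> b) :: real)"
      by (auto simp: indicator_def)
    have "freq_dot k x = k' \<bullet> x" by (simp add: freq_dot_def k'_def inner_vec_def)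
    also have "\<dots> = (\<Sum>b\<in>Basis. (k' \<bullet> b) * (x \<bullet> b))" by (rule euclidean_inner)
    finally have "torus_char k x = cis (\<Sum>b\<in>Basis. 2 * pi * ((k' \<bullet> b) * (x \<bullet> b)))"
      by (simp add: torus_char_def sum_distrib_left)
    also have "\<dots> = (\<Prod>b\<in>Basis. cis (2 * pi * ((k' \<bullet> b) * (x \<bullet> b))))"
      by (simp add: cis_conv_exp sum_distrib_left exp_sum)
    finally show ?thesis unfolding F_def ind scaleR_conv_of_real of_real_prod
      by (simp add: prod.distrib)
  qed
  interpret product_sigma_finite "\<lambda>b :: real ^ 'd. lborel :: real measure" by standard
  have meas: "F b \<in> borel_measurable borel" if "b \<in> Basis" for b
    using borel_measurable_integrable[OF int[OF that]] by simp
  have "integral (cbox 0 1) (torus_char k) = (LINT x:unit_cube|lborel. torus_char k x)"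
    by (rule unit_cube_integral[symmetric]) (intro continuous_intros)
  also have "\<dots> = (\<integral>x. (\<Prod>b\<in>Basis. F b (x \<bullet> b)) \<partial>lborel)"
    unfolding set_lebesgue_integral_def prod ..
  also have "\<dots> = (\<integral>g. (\<Prod>b\<in>Basis. F b ((\<Sum>c\<in>Basis. g c *\<^sub>R c) \<bullet> b)) \<partial>(\<Pi>\<^sub>M b\<in>Basis. lborel))"
    unfolding lborel_def[where 'a="real ^ 'd"] lborel_eq_real[symmetric] using meas
    by (intro integral_distr borel_measurable_prod) (auto intro!: measurable_compose[OF _ meas])
  also have "\<dots> = (\<integral>g. (\<Prod>b\<in>Basis. F b (g b)) \<partial>(\<Pi>\<^sub>M b\<in>Basis. lborel))"
    by (intro Bochner_Integration.integral_cong prod.cong) (auto simp: inner_sum_left inner_Basis if_distrib sum.delta cong: if_cong)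
  also have "\<dots> = (\<Prod>b\<in>Basis. integral\<^sup>L lborel (F b))"
    by (rule product_integral_prod) (auto intro: int)
  also have "\<dots> = (\<Prod>b\<in>Basis. if k' \<bullet> b = 0 then 1 else 0)"
  proof (rule prod.cong)
    fix b :: "real ^ 'd" assume "b \<in> Basis"
    then obtain s where "b = axis s 1" using basis by blast
    hence "k' \<bullet> b = of_int (k $ s)" by (simp add: inner_axis k'_def)
    thus "integral\<^sup>L lborel (F b) = (if k' \<bullet> b = 0 then 1 else 0)"
      unfolding F_def using integral_character_unit_interval[of "k $ s"] by simp
  qed simp
  also have "\<dots> = (if \<forall>b\<in>Basis. k' \<bullet> b = 0 then 1 else 0)" by (auto intro: prod.neutral)
  also have "(\<forall>b\<in>Basis. k' \<bullet> b = 0) \<longleftrightarrow> k = 0"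
    by (auto simp: Basis_vec_def inner_axis k'_def vec_eq_iff)
  finally show ?thesis .
qed

section \<open>Uniqueness of Fourier coefficients\<close>

lemma fourier_coeff_continuous:
  assumes "continuous_on UNIV f"
  shows "fourier_coeff f k = integral (cbox 0 1) (\<lambda>x. f x * torus_char (- k) x)"
  unfolding fourier_coeff_eq using assms by (intro unit_cube_integral continuous_intros)

lemma fourier_coeff_diff:
  assumes "continuous_on UNIV f" "continuous_on UNIV g"
  shows "fourier_coeff (\<lambda>x. f x - g x) k = fourier_coeff f k - fourier_coeff g k"
proof -
  have "(\<lambda>x. f x * torus_char (- k) x) integrable_on cbox 0 1" "(\<lambda>x. g x * torus_char (- k) x) integrable_on cbox 0 1"
    using assms by (auto intro!: integrable_continuous continuous_intros intro: continuous_on_subset)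
  thus ?thesis using assms
    by (simp add: fourier_coeff_continuous continuous_on_diff left_diff_distrib Henstock_Kurzweil_Integration.integral_diff)
qed

lemma fourier_coeff_trig_sum:
  assumes "finite I"
  shows "fourier_coeff (\<lambda>x. \<Sum>h\<in>I. c h * torus_char h x) k = (if k \<in> I then c k else 0)"
proof -
  have "fourier_coeff (\<lambda>x. \<Sum>h\<in>I. c h * torus_char h x) k
      = integral (cbox 0 1) (\<lambda>x. \<Sum>h\<in>I. c h * torus_char (h - k) x)"
    by (subst fourier_coeff_continuous)
       (auto intro!: continuous_intros simp: sum_distrib_right torus_char_add[symmetric] mult.assoc)
  also have "\<dots> = (\<Sum>h\<in>I. integral (cbox 0 1) (\<lambda>x. c h * torus_char (h - k) x))"
    using assms by (intro integral_sum) (auto intro!: integrable_continuous continuous_intros)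
  also have "\<dots> = (\<Sum>h\<in>I. if h = k then c h else 0)"
    by (intro sum.cong) (auto simp: integral_torus_char)
  finally show ?thesis using assms by (simp add: sum.delta)
qed

text \<open>
  Closure under products is not a rule but a lemma (\<open>trig_poly_mult\<close>); a linear functional that
  vanishes on all characters therefore vanishes on trigonometric polynomials by a direct induction.
\<close>

inductive trig_poly :: "(real ^ 'd \<Rightarrow> complex) \<Rightarrow> bool" where
  char: "trig_poly (torus_char k)"
| scale: "trig_poly p \<Longrightarrow> trig_poly (\<lambda>x. c * p x)"
| add: "trig_poly p \<Longrightarrow> trig_poly q \<Longrightarrow> trig_poly (\<lambda>x. p x + q x)"

lemma trig_poly_const: "trig_poly (\<lambda>x. c)"
  using trig_poly.scale[OF trig_poly.char[of 0], of c] by simp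

lemma trig_poly_mult:
  assumes "trig_poly p" "trig_poly q"
  shows "trig_poly (\<lambda>x. p x * q x)"
  using assms
proof (induction arbitrary: q)
  case (char k)
  from char.prems show ?case
  proof induction
    case (char h)
    have "trig_poly (torus_char (k + h))" by (rule trig_poly.char)
    also have "torus_char (k + h) = (\<lambda>x. torus_char k x * torus_char h x)"
      by (auto simp: torus_char_add)
    finally show ?case .
  next
    case (scale p c)
    from trig_poly.scale[OF scale.IH, of c] show ?case by (simp add: mult_ac)
  next
    case (add p q)
    from trig_poly.add[OF add.IH] show ?case by (simp add: distrib_left)
  qed
next
  case (scale p c)
  from trig_poly.scale[OF scale.IH[OF scale.prems], of c] show ?case by (simp add: mult_ac)
next
  case (add p q)
  from trig_poly.add[OF add.IH(1)[OF add.prems] add.IH(2)[OF add.prems]] show ?case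
    by (simp add: distrib_right)
qed

lemma trig_poly_sum:
  assumes "finite A" "\<And>a. a \<in> A \<Longrightarrow> trig_poly (p a)"
  shows "trig_poly (\<lambda>x. \<Sum>a\<in>A. p a x)"
  using assms by (induction A) (auto intro: trig_poly_const trig_poly.add)

lemma trig_poly_continuous:
  assumes "trig_poly p"
  shows "continuous_on A p"
  using assms by induction (auto intro!: continuous_intros)

definition torus_embed :: "real ^ 'd \<Rightarrow> complex ^ 'd" where
  "torus_embed x = (\<chi> s. cis (2 * pi * x $ s))"

definition circle_product :: "(complex ^ 'd) set" where
  "circle_product = {w. \<forall>s. cmod (w $ s) = 1}"

lemma torus_embed_in: "torus_embed x \<in> circle_product"
  by (simp add: torus_embed_def circle_product_def)

lemma compact_circle_product: "compact (circle_product :: (complex ^ 'd) set)"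
proof -
  have eq: "circle_product = (\<Inter>s. {w :: complex ^ 'd. cmod (w $ s) = 1})"
    by (auto simp: circle_product_def)
  have "closed {w :: complex ^ 'd. cmod (w $ s) = 1}" for s
    by (intro closed_Collect_eq continuous_intros)
  hence "closed (circle_product :: (complex ^ 'd) set)" unfolding eq by (intro closed_INT) auto
  moreover have "bounded (circle_product :: (complex ^ 'd) set)"
  proof (rule boundedI)
    fix w :: "complex ^ 'd" assume "w \<in> circle_product"
    hence "(\<Sum>s\<in>UNIV. norm (w $ s)) = (\<Sum>s\<in>(UNIV :: 'd set). 1)"
      unfolding circle_product_def by (intro sum.cong) auto
    moreover have "norm w \<le> (\<Sum>s\<in>UNIV. norm (w $ s))"
      unfolding norm_vec_def by (rule L2_set_le_sum) simp
    ultimately show "norm w \<le> real CARD('d)" by simp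
  qed
  ultimately show ?thesis by (simp add: compact_eq_bounded_closed)
qed

text \<open>
  A linear functional of the coordinates on the circles is a linear combination of their real and
  imaginary parts, and these are combinations of a character and its conjugate.
\<close>

lemma trig_poly_real_polynomial:
  fixes p :: "complex ^ 'd \<Rightarrow> real"
  assumes "real_polynomial_function p"
  shows "trig_poly (\<lambda>x. of_real (p (torus_embed x)))"
  using assms
proof induction
  case (linear h)
  have coord: "trig_poly (\<lambda>x. of_real (torus_embed x \<bullet> b))" if "b \<in> Basis" for b :: "complex ^ 'd"
  proof -
    obtain s u where b: "b = axis s u" using \<open>b \<in> Basis\<close> by (auto simp: Basis_vec_def)
    have fd: "freq_dot (axis s 1) x = x $ s" for x
    proof -
      have "freq_dot (axis s 1) x = (\<Sum>i\<in>UNIV. if i = s then x $ i else 0)"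
        unfolding freq_dot_def by (intro sum.cong) (auto simp: axis_def)
      thus ?thesis by simp
    qed
    have "trig_poly (\<lambda>x. (cnj u / 2) * torus_char (axis s 1) x + (u / 2) * torus_char (- axis s 1) x)"
      by (intro trig_poly.intros)
    also have "(\<lambda>x. (cnj u / 2) * torus_char (axis s 1) x + (u / 2) * torus_char (- axis s 1) x)
        = (\<lambda>x. of_real (torus_embed x \<bullet> b))"
    proof
      fix x
      show "(cnj u / 2) * torus_char (axis s 1) x + (u / 2) * torus_char (- axis s 1) x
        = of_real (torus_embed x \<bullet> b)"
        by (simp add: torus_char_def freq_dot_minus_left fd b inner_axis torus_embed_def inner_complex_def
            complex_eq_iff algebra_simps diff_divide_distrib)
    qed
    finally show ?thesis .
  qed
  have hw: "h w = (\<Sum>b\<in>Basis. (w \<bullet> b) * h b)" for w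
  proof -
    interpret bounded_linear h by fact
    have "h w = h (\<Sum>b\<in>Basis. (w \<bullet> b) *\<^sub>R b)" by (simp add: euclidean_representation)
    thus ?thesis by (simp add: sum scaleR)
  qed
  have "(\<lambda>x. complex_of_real (h (torus_embed x))) = (\<lambda>x. \<Sum>b\<in>Basis. of_real (h b) * of_real (torus_embed x \<bullet> b))"
    by (rule ext, subst hw) (simp add: mult.commute)
  moreover have "trig_poly (\<lambda>x. \<Sum>b\<in>Basis. of_real (h b) * of_real (torus_embed x \<bullet> b))"
    by (intro trig_poly_sum trig_poly.scale coord) auto
  ultimately show ?case by simp
next
  case (const c) show ?case by (rule trig_poly_const)
next
  case (add f g) thus ?case unfolding of_real_add by (intro trig_poly.add)
next
  case (mult f g) thus ?case unfolding of_real_mult by (intro trig_poly_mult)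
qed

text \<open>
  The torus is embedded as a compact subset of a Euclidean space, because the polynomial form of the
  Stone-Weierstrass theorem needs a compact domain whose points are separated; on the closed cube,
  opposite faces are not separated by periodic functions.
\<close>

lemma torus_continuous_factor:
  fixes f :: "real ^ 'd \<Rightarrow> complex"
  assumes "f \<in> torus_continuous"
  shows "\<exists>F. continuous_on circle_product F \<and> (\<forall>x. F (torus_embed x) = f x)"
proof -
  have per: "torus_function f" and cont: "continuous_on UNIV f"
    using assms by (auto simp: torus_continuous_def)
  define F where "F = (\<lambda>w :: complex ^ 'd. f (\<chi> s. Arg (w $ s) / (2 * pi)))"
  have cisArg: "cis (Arg z) = z" if "cmod z = 1" for z
    using that rcis_cmod_Arg[of z] by (simp add: rcis_def)
  have "F (torus_embed x) = f x" for x
    unfolding F_def by (rule torus_function_cong[OF per]) (simp add: torus_embed_def cisArg)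
  moreover have "continuous (at w0 within circle_product) F" if w0: "w0 \<in> circle_product" for w0
  proof -
    \<comment> \<open>Near \<open>w0\<close> the value of \<open>F\<close> does not change if the branch of the argument is cut opposite to \<open>w0\<close>.\<close>
    define G where "G = (\<lambda>w :: complex ^ 'd. f (\<chi> s. (Arg (w0 $ s) + Arg (w $ s / w0 $ s)) / (2 * pi)))"
    have nz: "w0 $ s \<noteq> 0" for s using w0 by (auto simp: circle_product_def dest: spec[of _ s])
    have "F w = G w" if w: "w \<in> circle_product" for w
      unfolding F_def G_def
    proof (rule torus_function_cong[OF per])
      fix s
      have "cmod (w $ s) = 1" "cmod (w0 $ s) = 1" using w w0 by (auto simp: circle_product_def)
      thus "cis (2 * pi * (\<chi> s. Arg (w $ s) / (2 * pi)) $ s) =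
        cis (2 * pi * (\<chi> s. (Arg (w0 $ s) + Arg (w $ s / w0 $ s)) / (2 * pi)) $ s)"
        using nz[of s] by (simp add: cisArg norm_divide flip: cis_mult)
    qed
    moreover have "continuous (at w0) G"
      unfolding G_def
    proof (rule continuous_at_compose[of w0 "\<lambda>w. \<chi> s. (Arg (w0 $ s) + Arg (w $ s / w0 $ s)) / (2 * pi)" f, unfolded o_def])
      have "isCont (\<lambda>w. Arg (w $ s / w0 $ s)) w0" for s
      proof (rule isCont_o2[of w0 "\<lambda>w. w $ s / w0 $ s" Arg])
        show "isCont (\<lambda>w. w $ s / w0 $ s) w0" using nz by (intro continuous_intros) auto
        show "isCont Arg (w0 $ s / w0 $ s)" using nz by (intro continuous_at_Arg) auto
      qed
      hence "isCont (\<lambda>w. (Arg (w0 $ s) + Arg (w $ s / w0 $ s)) / (2 * pi)) w0" for s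
        by (intro continuous_intros) auto
      thus "isCont (\<lambda>w. \<chi> s. (Arg (w0 $ s) + Arg (w $ s / w0 $ s)) / (2 * pi)) w0"
        unfolding isCont_def by (intro vec_tendstoI, unfold vec_lambda_beta)
      show "isCont f (\<chi> s. (Arg (w0 $ s) + Arg (w0 $ s / w0 $ s)) / (2 * pi))"
        using cont by (simp add: continuous_on_eq_continuous_at)
    qed
    ultimately show ?thesis using w0
      by (metis continuous_at_imp_continuous_at_within continuous_transform_within zero_less_one)
  qed
  ultimately show ?thesis by (auto simp: continuous_on_eq_continuous_within)
qed

lemma trig_poly_approx:
  fixes f :: "real ^ 'd \<Rightarrow> complex"
  assumes "f \<in> torus_continuous" "e > 0"
  shows "\<exists>p. trig_poly p \<and> (\<forall>x. norm (f x - p x) < e)"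
proof -
  obtain F where F: "continuous_on circle_product F" "\<And>x. F (torus_embed x) = f x"
    using torus_continuous_factor[OF assms(1)] by auto
  obtain g where g: "polynomial_function g" "\<And>w. w \<in> circle_product \<Longrightarrow> norm (F w - g w) < e"
    using Stone_Weierstrass_polynomial_function[OF compact_circle_product F(1) assms(2)] by auto
  define p where "p = (\<lambda>x. of_real (Re (g (torus_embed x))) + \<i> * of_real (Im (g (torus_embed x))))"
  have "real_polynomial_function (\<lambda>w. Re (g w))" "real_polynomial_function (\<lambda>w. Im (g w))"
    using g(1) bounded_linear_Re bounded_linear_Im by (auto simp: polynomial_function_def o_def)
  hence "trig_poly p"
    unfolding p_def by (intro trig_poly.intros trig_poly_real_polynomial)
  moreover have "p x = g (torus_embed x)" for x
    by (simp add: p_def complex_eq_iff)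
  hence "norm (f x - p x) < e" for x using g(2)[OF torus_embed_in[of x]] F(2) by simp
  ultimately show ?thesis by auto
qed

text \<open>
  If all coefficients of \<open>f\<close> vanish, then \<open>f\<close> is orthogonal to all trigonometric polynomials. Uniform
  approximation of the conjugate of \<open>f\<close> by these shows that the integral of \<open>\<bar>f\<bar>\<^sup>2\<close> vanishes.
\<close>

lemma fourier_coeff_zero_imp_zero:
  fixes f :: "real ^ 'd \<Rightarrow> complex"
  assumes f: "f \<in> torus_continuous" and zero: "\<And>k. fourier_coeff f k = 0"
  shows "f x = 0"
proof -
  let ?Q = "cbox 0 (1 :: real ^ 'd)"
  have per: "torus_function f" and cont: "continuous_on A f" for A
    using f by (auto simp: torus_continuous_def intro: continuous_on_subset)
  have intf: "(\<lambda>x. f x * p x) integrable_on ?Q" if "continuous_on ?Q p" for p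
    using that by (intro integrable_continuous continuous_intros cont)
  have orth: "integral ?Q (\<lambda>x. f x * p x) = 0" if "trig_poly p" for p
    using that
  proof induction
    case (char k)
    show ?case using zero[of "- k"] by (simp add: fourier_coeff_continuous[OF cont])
  next
    case (scale p c)
    have "(\<lambda>x. f x * (c * p x)) = (\<lambda>x. c * (f x * p x))" by (simp add: mult_ac)
    thus ?case using scale.IH by simp
  next
    case (add p q)
    thus ?case
      by (simp add: distrib_left Henstock_Kurzweil_Integration.integral_add intf trig_poly_continuous)
  qed
  define J where "J = integral ?Q (\<lambda>x. f x * cnj (f x))"
  have "bounded (f ` ?Q)"
    by (intro compact_imp_bounded compact_continuous_image cont compact_cbox)
  then obtain B where B: "B > 0" "\<And>x. x \<in> ?Q \<Longrightarrow> norm (f x) \<le> B"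
    unfolding bounded_pos by auto
  have cnjf: "(\<lambda>x. cnj (f x)) \<in> torus_continuous"
    using f by (auto simp: torus_continuous_def torus_function_def intro!: continuous_intros)
  have "norm J \<le> e" if e: "e > 0" for e
  proof -
    \<comment> \<open>The summand 1 only ensures that the divisor in \<open>\<delta>\<close> is positive.\<close>
    define c where "c = measure lborel ?Q + 1"
    have c: "c > 0" unfolding c_def using measure_nonneg[of lborel ?Q] by linarith
    define \<delta> where "\<delta> = e / (B * c)"
    have \<delta>: "\<delta> > 0" using e B c by (simp add: \<delta>_def)
    obtain p where p: "trig_poly p" "\<And>x. norm (cnj (f x) - p x) < \<delta>"
      using trig_poly_approx[OF cnjf \<delta>] by auto
    have "J = integral ?Q (\<lambda>x. f x * cnj (f x) - f x * p x)"
      unfolding J_def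
      by (subst Henstock_Kurzweil_Integration.integral_diff)
         (auto intro!: intf continuous_intros cont trig_poly_continuous[OF p(1)] simp: orth[OF p(1)])
    also have "\<dots> = integral ?Q (\<lambda>x. f x * (cnj (f x) - p x))" by (simp add: right_diff_distrib)
    finally have J: "((\<lambda>x. f x * (cnj (f x) - p x)) has_integral J) ?Q"
      by (auto intro!: integrable_integral intf continuous_intros cont trig_poly_continuous[OF p(1)])
    have "norm J \<le> (B * \<delta>) * measure lborel ?Q"
    proof (rule has_integral_bound[OF _ J])
      show "0 \<le> B * \<delta>" using B \<delta> by simp
      show "norm (f x * (cnj (f x) - p x)) \<le> B * \<delta>" if "x \<in> ?Q" for x
        unfolding norm_mult using B(2)[OF that] p(2)[of x] B \<delta> by (intro mult_mono) auto
    qed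
    also have "\<dots> \<le> (B * \<delta>) * c" using B \<delta> by (intro mult_left_mono) (auto simp: c_def)
    also have "\<dots> = e" using B c by (simp add: \<delta>_def)
    finally show ?thesis .
  qed
  hence "norm J \<le> 0" using field_le_epsilon[of "norm J" 0] by simp
  hence "J = 0" by simp
  moreover have "((\<lambda>x. f x * cnj (f x)) has_integral J) ?Q"
    unfolding J_def by (rule integrable_integral, rule intf) (intro continuous_intros cont)
  ultimately have "((\<lambda>x. f x * cnj (f x)) has_integral 0) ?Q" by simp
  from has_integral_linear[OF this bounded_linear_Re]
  have "((\<lambda>x. (cmod (f x))\<^sup>2) has_integral 0) ?Q"
    by (simp add: o_def cmod_power2) (simp add: power2_eq_square)
  hence Q: "(cmod (f x))\<^sup>2 = 0" if "x \<in> ?Q" for x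
    using that by (intro has_integral_0_cbox_imp_0[of 0 1 "\<lambda>x. (cmod (f x))\<^sup>2"])
      (auto intro!: continuous_intros cont simp: interval_ne_empty_cart)
  define y where "y = (\<chi> s. frac (x $ s))"
  have "f x = f y"
  proof (rule torus_function_cong[OF per])
    fix s
    have "2 * pi * x $ s = 2 * pi * frac (x $ s) + 2 * pi * of_int \<lfloor>x $ s\<rfloor>" by (simp add: frac_def algebra_simps)
    thus "cis (2 * pi * x $ s) = cis (2 * pi * y $ s)"
      using cis_multiple_2pi[of "of_int \<lfloor>x $ s\<rfloor>"] by (simp add: y_def flip: cis_mult)
  qed
  moreover have "y \<in> ?Q" by (simp add: y_def cube_eq less_imp_le frac_lt_1)
  ultimately show ?thesis using Q by simp
qed

section \<open>Absolutely convergent Fourier series and lattice averages\<close>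

lemma trig_series_continuous:
  fixes c :: "int ^ 'd \<Rightarrow> complex"
  assumes c: "(\<lambda>k. norm (c k)) summable_on UNIV"
  defines "g \<equiv> \<lambda>x. \<Sum>\<^sub>\<infinity>k. c k * torus_char k x"
  shows "g \<in> torus_continuous" "fourier_coeff g k = c k"
    "((\<lambda>k. c k * torus_char k x) has_sum g x) UNIV"
proof -
  have lim: "uniform_limit UNIV (\<lambda>I x. \<Sum>k\<in>I. c k * torus_char k x) g (finite_subsets_at_top UNIV)"
    unfolding g_def by (rule Weierstrass_m_test_general[OF _ c]) (simp add: norm_mult)
  have cont: "continuous_on UNIV g"
    by (rule uniform_limit_theorem[OF _ lim]) (auto intro!: always_eventually continuous_intros)
  have per: "torus_function g"
    unfolding torus_function_def g_def
    by (intro allI infsum_cong arg_cong2[where f = "(*)"] refl torus_function_torus_char[unfolded torus_function_def, rule_format])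
  show "g \<in> torus_continuous" using cont per by (simp add: torus_continuous_def)
  show "((\<lambda>k. c k * torus_char k x) has_sum g x) UNIV"
    unfolding g_def
    by (rule has_sum_infsum, rule abs_summable_summable) (use c in \<open>simp add: norm_mult\<close>)
  have "norm (fourier_coeff g k - c k) \<le> e" if e: "e > 0" for e
  proof -
    let ?Q = "cbox 0 (1 :: real ^ 'd)"
    define V where "V = measure lborel ?Q + 1"
    have V: "V > 0" unfolding V_def using measure_nonneg[of lborel ?Q] by linarith
    have "\<forall>\<^sub>F I in finite_subsets_at_top UNIV. \<forall>x\<in>UNIV. dist (\<Sum>k\<in>I. c k * torus_char k x) (g x) < e / V"
      using lim e V by (intro uniform_limitD) auto
    then obtain X where X: "finite X"
      "\<And>I x. finite I \<Longrightarrow> X \<subseteq> I \<Longrightarrow> dist (\<Sum>k\<in>I. c k * torus_char k x) (g x) < e / V"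
      unfolding eventually_finite_subsets_at_top by auto
    \<comment> \<open>Adding \<open>k\<close> to the finite set makes the coefficient of the partial sum at \<open>k\<close> equal to \<open>c k\<close>.\<close>
    define I where "I = insert k X"
    define S where "S = (\<lambda>x. \<Sum>k\<in>I. c k * torus_char k x)"
    have I: "finite I" "X \<subseteq> I" "k \<in> I" using X by (auto simp: I_def)
    have contS: "continuous_on UNIV S" unfolding S_def by (intro continuous_intros)
    have "fourier_coeff g k - c k = fourier_coeff (\<lambda>x. g x - S x) k"
      using fourier_coeff_diff[OF cont contS] fourier_coeff_trig_sum[of I c k] I by (simp add: S_def)
    also have "\<dots> = integral ?Q (\<lambda>x. (g x - S x) * torus_char (- k) x)"
      by (intro fourier_coeff_continuous continuous_intros cont contS)
    finally have "((\<lambda>x. (g x - S x) * torus_char (- k) x) has_integral (fourier_coeff g k - c k)) ?Q"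
      using integrable_integral[OF integrable_continuous[of 0 1 "\<lambda>x. (g x - S x) * torus_char (- k) x"]]
        continuous_on_subset[OF cont] continuous_on_subset[OF contS]
      by (simp add: continuous_intros)
    hence "norm (fourier_coeff g k - c k) \<le> e / V * measure lborel ?Q"
    proof (rule has_integral_bound[rotated])
      show "norm ((g x - S x) * torus_char (- k) x) \<le> e / V" for x
        using X(2)[OF I(1,2), of x] by (simp add: norm_mult dist_norm norm_minus_commute S_def less_imp_le)
    qed (use e V in simp)
    also have "\<dots> \<le> e / V * V" using e V by (intro mult_left_mono) (auto simp: V_def)
    finally show ?thesis using V by simp
  qed
  hence "norm (fourier_coeff g k - c k) \<le> 0"
    using field_le_epsilon[of "norm (fourier_coeff g k - c k)" 0] by simp
  thus "fourier_coeff g k = c k" by simp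
qed

text \<open>
  The sum of the Fourier series is a continuous function with the same Fourier coefficients as \<open>f\<close>, so
  the difference vanishes by uniqueness.
\<close>

lemma fourier_series_has_sum:
  fixes f :: "real ^ 'd \<Rightarrow> complex"
  assumes f: "f \<in> torus_continuous" and sm: "(\<lambda>k. norm (fourier_coeff f k)) summable_on UNIV"
  shows "((\<lambda>k. fourier_coeff f k * torus_char k x) has_sum f x) UNIV"
proof -
  define g where "g = (\<lambda>x. \<Sum>\<^sub>\<infinity>k. fourier_coeff f k * torus_char k x)"
  note g = trig_series_continuous[OF sm, folded g_def]
  have cont: "continuous_on UNIV f" "continuous_on UNIV g"
    using f g(1) by (auto simp: torus_continuous_def)
  have "(\<lambda>x. f x - g x) \<in> torus_continuous"
    using f g(1) by (auto simp: torus_continuous_def torus_function_def intro!: continuous_intros)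
  moreover have "fourier_coeff (\<lambda>x. f x - g x) k = 0" for k
    using fourier_coeff_diff[OF cont] g(2) by simp
  ultimately have "f x - g x = 0" by (rule fourier_coeff_zero_imp_zero)
  thus ?thesis using g(3)[of x] by (simp add: g_def)
qed

lemma torus_char_lattice_node:
  "torus_char h (lattice_node z m j) = cis (2 * pi * (real j * of_int (int_dot h z) / real m))"
proof -
  define a where "a = (\<lambda>s. real j / real m * of_int (z $ s))"
  have "freq_dot h (lattice_node z m j) = (\<Sum>s\<in>UNIV. of_int (h $ s) * a s) - of_int (\<Sum>s\<in>UNIV. h $ s * \<lfloor>a s\<rfloor>)"
    by (simp add: freq_dot_def lattice_node_def a_def frac_def right_diff_distrib sum_subtractf)
  also have "(\<Sum>s\<in>UNIV. of_int (h $ s) * a s) = real j * of_int (int_dot h z) / real m"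
    by (simp add: a_def int_dot_def sum_distrib_left sum_divide_distrib mult_ac)
  finally have "torus_char h (lattice_node z m j)
      = cis (2 * pi * (real j * of_int (int_dot h z) / real m)) * cis (- (2 * pi * of_int (\<Sum>s\<in>UNIV. h $ s * \<lfloor>a s\<rfloor>)))"
    by (simp only: torus_char_def cis_mult) (simp add: right_diff_distrib)
  also have "cis (- (2 * pi * of_int (\<Sum>s\<in>UNIV. h $ s * \<lfloor>a s\<rfloor>))) = 1"
    using cis_multiple_2pi[of "- of_int (\<Sum>s\<in>UNIV. h $ s * \<lfloor>a s\<rfloor>)"] by (simp del: of_int_sum)
  finally show ?thesis by simp
qed

lemma sum_roots_of_unity:
  assumes m: "m \<ge> 1"
  shows "(\<Sum>j<m. cis (2 * pi * (real j * of_int n / real m))) = (if int m dvd n then of_nat m else 0)"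
proof -
  define \<omega> where "\<omega> = cis (2 * pi * (of_int n / real m))"
  have pow: "cis (2 * pi * (real j * of_int n / real m)) = \<omega> ^ j" for j
  proof -
    have "real j * (2 * pi * (of_int n / real m)) = 2 * pi * (real j * of_int n / real m)" by simp
    thus ?thesis unfolding \<omega>_def Complex.DeMoivre by (simp only:)
  qed
  have one: "\<omega> ^ m = 1"
    using m cis_multiple_2pi[of "of_int n"] by (simp add: \<omega>_def Complex.DeMoivre)
  have "\<omega> = 1 \<longleftrightarrow> int m dvd n"
  proof
    assume "int m dvd n"
    then obtain q where "n = int m * q" by auto
    thus "\<omega> = 1" using m cis_multiple_2pi[of "of_int q"] by (simp add: \<omega>_def)
  next
    assume "\<omega> = 1"
    hence "exp (\<i> * complex_of_real (2 * pi * (of_int n / real m))) = 1"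
      by (simp only: \<omega>_def cis_conv_exp)
    then obtain q :: int where "2 * pi * (of_int n / real m) = real_of_int (2 * q) * pi"
      unfolding exp_eq_1 by auto
    hence "real_of_int n = real_of_int (q * int m)" using m by (simp add: field_simps)
    hence "n = q * int m" unfolding of_int_eq_iff .
    thus "int m dvd n" by simp
  qed
  thus ?thesis unfolding pow using one by (cases "\<omega> = 1") (simp_all add: geometric_sum)
qed

lemma has_sum_sum_lessThan:
  fixes f :: "nat \<Rightarrow> 'a \<Rightarrow> complex"
  assumes "\<And>j. (f j has_sum a j) A"
  shows "((\<lambda>h. \<Sum>j<m. f j h) has_sum (\<Sum>j<m. a j)) A"
proof (induction m)
  case (Suc m)
  from has_sum_add[OF Suc assms[of m]] show ?case by simp
qed simp

text \<open>
  Averaging the character \<open>h\<close> times the conjugate of the character \<open>k\<close> over the nodes is averaging powers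
  of a root of unity, which gives 1 if \<open>h\<close> and \<open>k\<close> are congruent on the lattice and 0 otherwise. Only the
  coefficients in the congruence class of \<open>k\<close> survive.
\<close>

lemma lattice_coeff_has_sum:
  fixes f :: "real ^ 'd \<Rightarrow> complex"
  assumes f: "f \<in> torus_continuous" and sm: "(\<lambda>k. norm (fourier_coeff f k)) summable_on UNIV"
    and m: "m \<ge> 1"
  shows "(fourier_coeff f has_sum lattice_coeff z m f k) {h. [int_dot h z = int_dot k z] (mod int m)}"
proof -
  define e where "e = (\<lambda>j. cis (- (2 * pi * (real j * of_int (int_dot k z) / real m))))"
  have e: "exp (- 2 * pi * \<i> * j * of_int (int_dot k z) / m) = e j" for j :: nat
    by (simp add: e_def cis_conv_exp mult_ac)
  have "((\<lambda>h. fourier_coeff f h * torus_char h (lattice_node z m j) * e j) has_sum (f (lattice_node z m j) * e j)) UNIV" for j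
    by (intro has_sum_cmult_left fourier_series_has_sum f sm)
  hence "((\<lambda>h. \<Sum>j<m. fourier_coeff f h * torus_char h (lattice_node z m j) * e j)
      has_sum (\<Sum>j<m. f (lattice_node z m j) * e j)) UNIV"
    by (rule has_sum_sum_lessThan)
  hence "((\<lambda>h. 1 / of_nat m * (\<Sum>j<m. fourier_coeff f h * torus_char h (lattice_node z m j) * e j))
      has_sum (1 / of_nat m * (\<Sum>j<m. f (lattice_node z m j) * e j))) UNIV"
    by (rule has_sum_cmult_right)
  also have "1 / of_nat m * (\<Sum>j<m. f (lattice_node z m j) * e j) = lattice_coeff z m f k"
    unfolding lattice_coeff_def e ..
  also have "(\<lambda>h. 1 / of_nat m * (\<Sum>j<m. fourier_coeff f h * torus_char h (lattice_node z m j) * e j))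
      = (\<lambda>h. if [int_dot h z = int_dot k z] (mod int m) then fourier_coeff f h else 0)"
  proof
    fix h
    have tc: "torus_char h (lattice_node z m j) * e j = cis (2 * pi * (real j * of_int (int_dot h z - int_dot k z) / real m))" for j
      by (simp add: torus_char_lattice_node e_def cis_mult diff_divide_distrib right_diff_distrib)
    have "(\<Sum>j<m. fourier_coeff f h * torus_char h (lattice_node z m j) * e j)
        = fourier_coeff f h * (\<Sum>j<m. torus_char h (lattice_node z m j) * e j)"
      by (simp only: mult.assoc sum_distrib_left)
    also have "\<dots> = fourier_coeff f h * (if int m dvd int_dot h z - int_dot k z then of_nat m else 0)"
      by (simp only: tc sum_roots_of_unity[OF m])
    finally have "(\<Sum>j<m. fourier_coeff f h * torus_char h (lattice_node z m j) * e j)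
        = fourier_coeff f h * (if int m dvd int_dot h z - int_dot k z then of_nat m else 0)" .
    thus "1 / of_nat m * (\<Sum>j<m. fourier_coeff f h * torus_char h (lattice_node z m j) * e j)
      = (if [int_dot h z = int_dot k z] (mod int m) then fourier_coeff f h else 0)"
      using m by (simp add: cong_iff_dvd_diff)
  qed
  finally show ?thesis
    by (rule has_sum_cong_neutral[THEN iffD1, rotated 3]) auto
qed

section \<open>Truncation and aliasing error\<close>

lemma freq_prod_summable:
  assumes "a > 1"
  shows "(\<lambda>k :: int ^ 'd. freq_prod k powr (- a)) summable_on UNIV"
proof (rule nonneg_bdd_above_summable_on)
  define S where "S = (1 + 2 * (1 + 1 / (a - 1))) ^ CARD('d)"
  have "sum (\<lambda>k. freq_prod k powr (- a)) F \<le> S" if F: "finite F" for F :: "(int ^ 'd) set"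
  proof -
    define K where "K = nat (\<Sum>k\<in>F. \<Sum>s\<in>UNIV. \<bar>k $ s\<bar>)"
    let ?Q = "{k :: int ^ 'd. \<forall>s. k $ s \<in> {-int K..int K}}"
    have "F \<subseteq> ?Q"
    proof clarify
      fix k s assume "k \<in> F"
      have "\<bar>k $ s\<bar> \<le> (\<Sum>s\<in>UNIV. \<bar>k $ s\<bar>)" by (rule member_le_sum) auto
      also have "\<dots> \<le> (\<Sum>k\<in>F. \<Sum>s\<in>UNIV. \<bar>k $ s\<bar>)"
        using F \<open>k \<in> F\<close> by (intro member_le_sum[of k F "\<lambda>k. \<Sum>s\<in>UNIV. \<bar>k $ s\<bar>"]) (auto intro: sum_nonneg)
      also have "\<dots> = int K" unfolding K_def by (simp add: sum_nonneg)
      finally show "k $ s \<in> {-int K..int K}" by auto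
    qed
    moreover have "finite ?Q" by (rule sum_box_prod) auto
    ultimately have "sum (\<lambda>k. freq_prod k powr (- a)) F \<le> (\<Sum>k\<in>?Q. freq_prod k powr (- a))"
      by (intro sum_mono2) auto
    also have "\<dots> = (\<Sum>k\<in>?Q. \<Prod>s\<in>UNIV. max 1 \<bar>real_of_int (k $ s)\<bar> powr (- a))"
      unfolding freq_prod_def by (subst prod_powr_distrib) auto
    also have "\<dots> = (\<Sum>j=-int K..int K. max 1 \<bar>real_of_int j\<bar> powr (- a)) ^ CARD('d)"
      by (subst sum_box_prod) auto
    also have "(\<Sum>j=-int K..int K. max 1 \<bar>real_of_int j\<bar> powr (- a)) = 1 + 2 * (\<Sum>p=1..K. real p powr (- a))"
      using sum_symmetric_interval[of "\<lambda>x. x powr (- a)" K] by simp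
    also have "\<dots> ^ CARD('d) \<le> S"
      unfolding S_def using sum_powr_all[OF assms, of K]
      by (intro power_mono add_left_mono mult_left_mono) (auto intro!: add_nonneg_nonneg sum_nonneg)
    finally show ?thesis .
  qed
  thus "bdd_above (sum (\<lambda>k :: int ^ 'd. freq_prod k powr (- a)) ` {F. F \<subseteq> UNIV \<and> finite F})"
    by (intro bdd_aboveI[of _ S]) auto
qed simp

lemma weight_lower:
  fixes k :: "int ^ 'd"
  assumes "b \<ge> 0" "a + b \<ge> 0"
  shows "real CARD('d) powr (- b) \<le> weight a b k"
proof -
  let ?n = "freq_size k" and ?d = "real CARD('d)"
  have "1 \<le> ?n powr (a + b)" using assms freq_size_ge_1[of k] by (intro ge_one_powr_ge_zero) auto
  hence "?d powr (- b) * 1 \<le> ?d powr (- b) * ?n powr (a + b)" by (intro mult_left_mono) auto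
  also have "\<dots> \<le> weight a b k" using assms by (intro weight_ge_freq_size_powr)
  finally show ?thesis by simp
qed

text \<open>
  Both parts come from the finite inequality: the partial sums of \<open>\<bar>c\<bar>\<close> are bounded uniformly.
\<close>

lemma infsum_Cauchy_Schwarz:
  fixes c :: "'a \<Rightarrow> complex" and w :: "'a \<Rightarrow> real"
  assumes w: "\<And>h. h \<in> A \<Longrightarrow> w h > 0"
    and U: "(\<lambda>h. (w h)\<^sup>2 * (cmod (c h))\<^sup>2) summable_on A"
    and V: "(\<lambda>h. (1 / w h)\<^sup>2) summable_on A"
  shows "(\<lambda>h. cmod (c h)) summable_on A"
    and "(c has_sum s) A \<Longrightarrow>
      (cmod s)\<^sup>2 \<le> (\<Sum>\<^sub>\<infinity>h\<in>A. (1 / w h)\<^sup>2) * (\<Sum>\<^sub>\<infinity>h\<in>A. (w h)\<^sup>2 * (cmod (c h))\<^sup>2)"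
proof -
  let ?U = "\<Sum>\<^sub>\<infinity>h\<in>A. (w h)\<^sup>2 * (cmod (c h))\<^sup>2" and ?V = "\<Sum>\<^sub>\<infinity>h\<in>A. (1 / w h)\<^sup>2"
  have fin: "sum (\<lambda>h. cmod (c h)) F \<le> sqrt (?V * ?U)" if F: "finite F" "F \<subseteq> A" for F
  proof (rule real_le_rsqrt)
    have "sum (\<lambda>h. cmod (c h)) F = (\<Sum>h\<in>F. (1 / w h) * (w h * cmod (c h)))"
      using w F by (intro sum.cong) (auto simp: less_imp_neq[symmetric] dest!: subsetD)
    hence "(sum (\<lambda>h. cmod (c h)) F)\<^sup>2 \<le> (\<Sum>h\<in>F. (1 / w h)\<^sup>2) * (\<Sum>h\<in>F. (w h * cmod (c h))\<^sup>2)"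
      using Cauchy_Schwarz_ineq_sum[of "\<lambda>h. 1 / w h" "\<lambda>h. w h * cmod (c h)" F] by simp
    also have "\<dots> \<le> ?V * ?U"
      using F U V unfolding power_mult_distrib
      by (intro mult_mono finite_sum_le_infsum sum_nonneg infsum_nonneg) auto
    finally show "(sum (\<lambda>h. cmod (c h)) F)\<^sup>2 \<le> ?V * ?U" .
  qed
  show sm: "(\<lambda>h. cmod (c h)) summable_on A"
    by (rule nonneg_bdd_above_summable_on) (use fin in \<open>auto intro!: bdd_aboveI[of _ "sqrt (?V * ?U)"]\<close>)
  assume s: "(c has_sum s) A"
  have "cmod s \<le> (\<Sum>\<^sub>\<infinity>h\<in>A. cmod (c h))"
    using norm_has_sum_bound[OF has_sum_infsum[OF sm] s] .
  also have "\<dots> \<le> sqrt (?V * ?U)" by (rule infsum_le_finite_sums[OF sm fin])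
  finally have "(cmod s)\<^sup>2 \<le> (sqrt (?V * ?U))\<^sup>2" by (intro power_mono) auto
  moreover have "?V * ?U \<ge> 0" by (intro mult_nonneg_nonneg infsum_nonneg) auto
  ultimately show "(cmod s)\<^sup>2 \<le> ?V * ?U" by simp
qed

text \<open>
  A reconstructed frequency is the only member of \<open>I\<close> in its congruence class, so the aliasing error
  collects Fourier coefficients from off \<open>I\<close> only.
\<close>

lemma alias_has_sum:
  fixes f :: "real ^ 'd \<Rightarrow> complex"
  assumes f: "f \<in> torus_continuous" "(\<lambda>k. norm (fourier_coeff f k)) summable_on UNIV"
    and m: "m \<ge> 1" and k: "k \<in> recon_part I z m"
  shows "(fourier_coeff f has_sum (lattice_coeff z m f k - fourier_coeff f k))
    {h. h \<notin> I \<and> [int_dot h z = int_dot k z] (mod int m)}"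
proof -
  let ?B = "{h. [int_dot h z = int_dot k z] (mod int m)}"
  have "{h. h \<notin> I \<and> [int_dot h z = int_dot k z] (mod int m)} = ?B - {k}"
  proof -
    have "h \<notin> I \<or> h = k" if "[int_dot h z = int_dot k z] (mod int m)" for h
      using k cong_sym[OF that] unfolding recon_part_def by blast
    moreover have "k \<in> I" using k by (simp add: recon_part_def)
    ultimately show ?thesis by auto
  qed
  moreover have "(fourier_coeff f has_sum (lattice_coeff z m f k - fourier_coeff f k)) (?B - {k})"
    by (rule has_sum_Diff[OF lattice_coeff_has_sum[OF f m]]) (auto intro: has_sum_finiteI)
  ultimately show ?thesis by simp
qed

text \<open>
  The congruence classes of reconstructed frequencies are pairwise disjoint. After Cauchy-Schwarz in
  each class, the sums over the classes therefore add up to at most one sum over all frequencies,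
  with no dependence on the lattice.
\<close>

lemma alias_sum_bound:
  fixes f :: "real ^ 'd \<Rightarrow> complex" and w :: "int ^ 'd \<Rightarrow> real"
  assumes f: "f \<in> torus_continuous"
    and w: "\<And>h. w h > 0"
    and U: "(\<lambda>h. (w h)\<^sup>2 * (cmod (fourier_coeff f h))\<^sup>2) summable_on UNIV"
    and V: "(\<lambda>h. (1 / w h)\<^sup>2) summable_on UNIV"
    and m: "m \<ge> 1" and I: "finite I"
  shows "(\<Sum>k\<in>recon_part I z m. (cmod (lattice_coeff z m f k - fourier_coeff f k))\<^sup>2)
    \<le> (\<Sum>\<^sub>\<infinity>h\<in>-I. (1 / w h)\<^sup>2) * (\<Sum>\<^sub>\<infinity>h. (w h)\<^sup>2 * (cmod (fourier_coeff f h))\<^sup>2)"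
proof -
  let ?u = "\<lambda>h. (w h)\<^sup>2 * (cmod (fourier_coeff f h))\<^sup>2" and ?v = "\<lambda>h. (1 / w h)\<^sup>2"
  let ?J = "recon_part I z m"
  define A where "A = (\<lambda>k. {h. h \<notin> I \<and> [int_dot h z = int_dot k z] (mod int m)})"
  have subU: "?u summable_on B" and subV: "?v summable_on B" for B
    using U V by (auto intro: summable_on_subset_banach)
  have V0: "(\<Sum>\<^sub>\<infinity>h\<in>-I. ?v h) \<ge> 0" by (rule infsum_nonneg) auto
  have abs: "(\<lambda>k. norm (fourier_coeff f k)) summable_on UNIV"
    by (rule infsum_Cauchy_Schwarz(1)[OF w U V])
  have "(cmod (lattice_coeff z m f k - fourier_coeff f k))\<^sup>2 \<le> (\<Sum>\<^sub>\<infinity>h\<in>-I. ?v h) * (\<Sum>\<^sub>\<infinity>h\<in>A k. ?u h)"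
    if k: "k \<in> ?J" for k
  proof -
    have "(cmod (lattice_coeff z m f k - fourier_coeff f k))\<^sup>2 \<le> (\<Sum>\<^sub>\<infinity>h\<in>A k. ?v h) * (\<Sum>\<^sub>\<infinity>h\<in>A k. ?u h)"
      using alias_has_sum[OF f abs m k] unfolding A_def
      by (intro infsum_Cauchy_Schwarz(2) w subU subV)
    also have "\<dots> \<le> (\<Sum>\<^sub>\<infinity>h\<in>-I. ?v h) * (\<Sum>\<^sub>\<infinity>h\<in>A k. ?u h)"
      by (intro mult_right_mono infsum_mono2 subV infsum_nonneg) (auto simp: A_def)
    finally show ?thesis .
  qed
  hence "(\<Sum>k\<in>?J. (cmod (lattice_coeff z m f k - fourier_coeff f k))\<^sup>2)
      \<le> (\<Sum>k\<in>?J. (\<Sum>\<^sub>\<infinity>h\<in>-I. ?v h) * (\<Sum>\<^sub>\<infinity>h\<in>A k. ?u h))"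
    by (rule sum_mono)
  also have "\<dots> = (\<Sum>\<^sub>\<infinity>h\<in>-I. ?v h) * (\<Sum>k\<in>?J. \<Sum>\<^sub>\<infinity>h\<in>A k. ?u h)" by (rule sum_distrib_left[symmetric])
  also have "(\<Sum>k\<in>?J. \<Sum>\<^sub>\<infinity>h\<in>A k. ?u h) = (\<Sum>\<^sub>\<infinity>h\<in>(\<Union>k\<in>?J. A k). ?u h)"
  proof (rule sum_infsum)
    show "finite ?J" using I by (simp add: recon_part_def)
    show "A k \<inter> A k' = {}" if "k \<in> ?J" "k' \<in> ?J" "k \<noteq> k'" for k k'
    proof -
      have "\<not> [int_dot k z = int_dot k' z] (mod int m)" using that by (auto simp: recon_part_def)
      thus ?thesis unfolding A_def using cong_sym cong_trans by blast
    qed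
  qed (rule subU)
  also have "(\<Sum>\<^sub>\<infinity>h\<in>-I. ?v h) * (\<Sum>\<^sub>\<infinity>h\<in>(\<Union>k\<in>?J. A k). ?u h) \<le> (\<Sum>\<^sub>\<infinity>h\<in>-I. ?v h) * (\<Sum>\<^sub>\<infinity>h. ?u h)"
    using V0 by (intro mult_left_mono infsum_mono2 subU) auto
  finally show ?thesis .
qed

text \<open>
  The square of an average is at most the sum of the squares, and each of the \<open>L\<close> lattices contributes
  at most the bound for a single lattice.
\<close>

lemma multi_coeff_error_bound:
  fixes f :: "real ^ 'd \<Rightarrow> complex" and w :: "int ^ 'd \<Rightarrow> real"
  assumes f: "f \<in> torus_continuous"
    and w: "\<And>h. w h > 0"
    and U: "(\<lambda>h. (w h)\<^sup>2 * (cmod (fourier_coeff f h))\<^sup>2) summable_on UNIV"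
    and V: "(\<lambda>h. (1 / w h)\<^sup>2) summable_on UNIV"
    and m: "\<And>l. l \<in> {1..L} \<Longrightarrow> m l \<ge> 1" and I: "finite I"
    and rec: "reconstruction_property L z m I"
  shows "(\<Sum>k\<in>I. (cmod (multi_coeff L z m I f k - fourier_coeff f k))\<^sup>2)
    \<le> real L * ((\<Sum>\<^sub>\<infinity>h\<in>-I. (1 / w h)\<^sup>2) * (\<Sum>\<^sub>\<infinity>h. (w h)\<^sup>2 * (cmod (fourier_coeff f h))\<^sup>2))"
proof -
  define e where "e = (\<lambda>l k. lattice_coeff (z l) (m l) f k - fourier_coeff f k)"
  have "(cmod (multi_coeff L z m I f k - fourier_coeff f k))\<^sup>2 \<le> (\<Sum>l | l \<in> {1..L} \<and> k \<in> recon_part I (z l) (m l). (cmod (e l k))\<^sup>2)"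
    if k: "k \<in> I" for k
  proof -
    define R where "R = recon_indices L z m I k"
    have "k \<in> (\<Union>l\<in>{1..L}. recon_part I (z l) (m l))"
      using rec k by (simp only: reconstruction_property_def)
    hence R: "finite R" "R \<noteq> {}" by (auto simp: R_def recon_indices_def)
    define n where "n = real (card R)"
    have n: "n \<ge> 1" using R unfolding n_def by (metis One_nat_def Suc_leI card_gt_0_iff of_nat_1 of_nat_mono)
    have "multi_coeff L z m I f k - fourier_coeff f k = (1 / of_nat (card R)) * (\<Sum>l\<in>R. e l k)"
      using R by (simp add: multi_coeff_def e_def R_def[symmetric] sum_subtractf field_simps)
    hence "cmod (multi_coeff L z m I f k - fourier_coeff f k) = cmod (\<Sum>l\<in>R. e l k) / n"
      by (simp add: norm_mult norm_divide n_def)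
    also have "\<dots> \<le> (\<Sum>l\<in>R. cmod (e l k)) / n"
      using n by (intro divide_right_mono norm_sum) auto
    finally have "(cmod (multi_coeff L z m I f k - fourier_coeff f k))\<^sup>2 \<le> ((\<Sum>l\<in>R. 1 * cmod (e l k)) / n)\<^sup>2"
      by (intro power_mono) auto
    also have "\<dots> \<le> ((\<Sum>l\<in>R. 1\<^sup>2) * (\<Sum>l\<in>R. (cmod (e l k))\<^sup>2)) / n\<^sup>2"
      unfolding power_divide by (intro divide_right_mono Cauchy_Schwarz_ineq_sum) auto
    also have "\<dots> = (\<Sum>l\<in>R. (cmod (e l k))\<^sup>2) / n"
      using n by (simp add: n_def[symmetric] power2_eq_square)
    also have "\<dots> \<le> (\<Sum>l\<in>R. (cmod (e l k))\<^sup>2) / 1"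
      using n by (intro divide_left_mono sum_nonneg) auto
    finally show ?thesis by (simp add: R_def recon_indices_def)
  qed
  hence "(\<Sum>k\<in>I. (cmod (multi_coeff L z m I f k - fourier_coeff f k))\<^sup>2)
      \<le> (\<Sum>k\<in>I. \<Sum>l | l \<in> {1..L} \<and> k \<in> recon_part I (z l) (m l). (cmod (e l k))\<^sup>2)"
    by (rule sum_mono)
  also have "\<dots> = (\<Sum>l\<in>{1..L}. \<Sum>k | k \<in> I \<and> k \<in> recon_part I (z l) (m l). (cmod (e l k))\<^sup>2)"
    by (rule sum.swap_restrict) (use I in auto)
  also have "\<dots> = (\<Sum>l\<in>{1..L}. \<Sum>k\<in>recon_part I (z l) (m l). (cmod (e l k))\<^sup>2)"
    by (intro sum.cong) (auto simp: recon_part_def)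
  also have "\<dots> \<le> (\<Sum>l\<in>{1..L}. (\<Sum>\<^sub>\<infinity>h\<in>-I. (1 / w h)\<^sup>2) * (\<Sum>\<^sub>\<infinity>h. (w h)\<^sup>2 * (cmod (fourier_coeff f h))\<^sup>2))"
    unfolding e_def by (intro sum_mono alias_sum_bound f w U V m I)
  finally show ?thesis by simp
qed

lemma shape_less_1:
  assumes "T \<le> neg_quot a b" "b \<ge> 0" "a + b > 0"
  shows "T < 1"
proof (cases T)
  case (real T')
  hence "a + T' * b \<le> 0" "b > 0" using neg_quot_upper[of T' a b] assms by auto
  hence "T' * b < 1 * b" using assms(3) by linarith
  thus ?thesis using real \<open>b > 0\<close> by simp
qed (use assms in \<open>auto simp: neg_quot_def split: if_splits\<close>)

lemma sampling_error_coeff: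
  fixes f :: "real ^ 'd \<Rightarrow> complex" and L :: nat and z :: "nat \<Rightarrow> int ^ 'd" and m :: "nat \<Rightarrow> nat"
  assumes f: "f \<in> torus_continuous" and I: "finite I"
  defines "err \<equiv> \<lambda>x. f x - sampling_operator L z m I f x"
  shows "err \<in> torus_continuous"
    and "fourier_coeff err k = fourier_coeff f k - (if k \<in> I then multi_coeff L z m I f k else 0)"
proof -
  have s: "sampling_operator L z m I f = (\<lambda>x. \<Sum>k\<in>I. multi_coeff L z m I f k * torus_char k x)"
    by (simp only: sampling_operator_def fun_eq_iff exp_eq_torus_char simp_thms)
  have cont: "continuous_on UNIV f" "continuous_on UNIV (sampling_operator L z m I f)"
    using f unfolding s torus_continuous_def by (auto intro!: continuous_intros)
  have "torus_function (sampling_operator L z m I f)"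
    unfolding s torus_function_def
    by (intro allI sum.cong arg_cong2[where f = "(*)"] refl torus_function_torus_char[unfolded torus_function_def, rule_format])
  thus "err \<in> torus_continuous"
    using f cont by (auto simp: torus_continuous_def torus_function_def err_def intro!: continuous_intros)
  show "fourier_coeff err k = fourier_coeff f k - (if k \<in> I then multi_coeff L z m I f k else 0)"
    unfolding err_def using fourier_coeff_diff[OF cont] I by (simp add: s fourier_coeff_trig_sum)
qed

text \<open>
  In the proof, \<open>a\<close> controls the frequencies off the index set and \<open>b\<close> the aliasing on it; \<open>S\<close> is the
  sum that converges because \<open>\<lambda> > 1/2\<close>. The truncation part does not grow with \<open>L\<close>, and the aliasing
  part grows like the square root of \<open>L\<close>; both are estimated by the first power of \<open>L\<close>.
\<close>

lemma sampling_error_bound: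
  fixes \<alpha> \<beta> lam r t :: real and T :: ereal
  assumes par: "lam > 1/2" "\<beta> \<ge> lam" "t \<ge> 0" "\<beta> - lam \<ge> t" "r + t \<ge> 0" "\<alpha> + \<beta> - lam > r + t"
    and T: "T \<ge> neg_quot r t" "T \<le> neg_quot \<alpha> (\<beta> - lam)" "T \<le> neg_quot (\<alpha> - r) (\<beta> - lam - t)"
  shows "\<exists>K>0. \<forall>(N::real) (f :: real ^ 'd \<Rightarrow> complex) L z m.
     N \<ge> 1 \<longrightarrow> f \<in> hspace \<alpha> \<beta> \<inter> torus_continuous \<longrightarrow> L \<ge> 1 \<longrightarrow> (\<forall>l\<in>{1..L}. m l \<ge> 1) \<longrightarrow>
     reconstruction_property L z m (index_set N T) \<longrightarrow>
     (\<lambda>x. f x - sampling_operator L z m (index_set N T) f x) \<in> hspace r t \<and>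
     hnorm r t (\<lambda>x. f x - sampling_operator L z m (index_set N T) f x)
       \<le> K * N powr (- (\<alpha> - r + \<beta> - t - lam)) * real L * hnorm \<alpha> \<beta> f"
proof -
  define d where "d = real CARD('d)"
  define \<gamma> where "\<gamma> = \<alpha> - r + \<beta> - t - lam"
  define S where "S = (\<Sum>\<^sub>\<infinity>h :: int ^ 'd. freq_prod h powr (- (2 * lam)))"
  define a where "a = d powr (\<beta> - lam - t)"
  define b where "b = d powr ((r + real_of_ereal T * t) / (1 - real_of_ereal T)) * d powr (\<beta> - lam)"
  define K where "K = a\<^sup>2 + b\<^sup>2 * S"
  have d: "d \<ge> 1" unfolding d_def by (rule dim_ge_1)
  have T1: "T < 1" by (rule shape_less_1[OF T(2)]) (use par in auto)
  have T2: "T < \<infinity>" using T1 by (cases T) auto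
  have sumS: "(\<lambda>h :: int ^ 'd. freq_prod h powr (- (2 * lam))) summable_on UNIV"
    using par by (intro freq_prod_summable) auto
  have S: "S \<ge> 0" unfolding S_def by (rule infsum_nonneg) auto
  have a: "a > 0" using d by (simp add: a_def)
  have K: "K > 0" unfolding K_def using a S by (intro add_pos_nonneg) auto
  show ?thesis
  proof (intro exI[of _ "sqrt K"] conjI allI impI)
    show "sqrt K > 0" using K by simp
    fix N :: real and f :: "real ^ 'd \<Rightarrow> complex" and L :: nat and z :: "nat \<Rightarrow> int ^ 'd" and m :: "nat \<Rightarrow> nat"
    assume N: "N \<ge> 1" and f: "f \<in> hspace \<alpha> \<beta> \<inter> torus_continuous" and L: "L \<ge> 1"
      and m: "\<forall>l\<in>{1..L}. m l \<ge> 1" and rec: "reconstruction_property L z m (index_set N T)"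
    define I where "I = (index_set N T :: (int ^ 'd) set)"
    define err where "err = (\<lambda>x. f x - sampling_operator L z m I f x)"
    define w where "w = (weight \<alpha> \<beta> :: int ^ 'd \<Rightarrow> real)"
    define u where "u = (\<lambda>h. (w h)\<^sup>2 * (cmod (fourier_coeff f h))\<^sup>2)"
    define v where "v = (\<lambda>h. (1 / w h)\<^sup>2)"
    define E where "E = N powr (- \<gamma>)"
    have E: "E > 0" using N by (simp add: E_def)
    have fc: "f \<in> torus_continuous" using f by simp
    have finI: "finite I" unfolding I_def using finite_index_set[OF T1 N] .
    have u: "u summable_on UNIV" using f by (simp add: u_def w_def hspace_def)
    have u0: "infsum u UNIV \<ge> 0" by (rule infsum_nonneg) (simp add: u_def)
    have w: "w h > 0" for h by (simp add: w_def weight_pos)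
    \<comment> \<open>The first factor is large off \<open>I\<close>, the second one has square-summable reciprocals.\<close>
    have wsplit: "w h = weight \<alpha> (\<beta> - lam) h * freq_prod h powr lam" for h
      using weight_add[of \<alpha> 0 "\<beta> - lam" lam h] freq_size_pos[of h] by (simp add: w_def weight_eq)
    have v_le: "v h \<le> 1 / D\<^sup>2 * freq_prod h powr (- (2 * lam))"
      if D: "D > 0" "D \<le> weight \<alpha> (\<beta> - lam) h" for D h
    proof -
      have "D * freq_prod h powr lam \<le> w h" unfolding wsplit using D by (intro mult_right_mono) auto
      hence "(1 / w h)\<^sup>2 \<le> (1 / (D * freq_prod h powr lam))\<^sup>2"
        using D w[of h] freq_prod_pos[of h] by (intro power_mono divide_left_mono) auto
      also have "\<dots> = 1 / D\<^sup>2 * freq_prod h powr (- (2 * lam))"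
        using freq_prod_pos[of h] by (simp add: power_divide power_mult_distrib powr_minus powr_power field_simps)
      finally show ?thesis by (simp add: v_def)
    qed
    have v: "v summable_on UNIV"
    proof (rule summable_on_comparison_test[OF summable_on_cmult_right[OF sumS]])
      show "v h \<le> 1 / (d powr (- (\<beta> - lam)))\<^sup>2 * freq_prod h powr (- (2 * lam))" for h :: "int ^ 'd"
        using d weight_lower[of "\<beta> - lam" \<alpha> h] par by (intro v_le) (auto simp: d_def)
    qed (simp add: v_def)
    have V: "infsum v (-I) \<le> (d powr (\<beta> - lam) * N powr (- (\<alpha> + \<beta> - lam)))\<^sup>2 * S"
    proof -
      define D where "D = d powr (- (\<beta> - lam)) * N powr (\<alpha> + (\<beta> - lam))"
      have D: "D > 0" using d N by (simp add: D_def)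
      have "infsum v (-I) \<le> (\<Sum>\<^sub>\<infinity>h\<in>-I. 1 / D\<^sup>2 * freq_prod h powr (- (2 * lam)))"
      proof (rule infsum_mono)
        show "v summable_on -I" using v by (rule summable_on_subset_banach) auto
        show "(\<lambda>h. 1 / D\<^sup>2 * freq_prod h powr (- (2 * lam))) summable_on -I"
          using summable_on_cmult_right[OF sumS] by (rule summable_on_subset_banach) auto
        fix h assume "h \<in> -I"
        thus "v h \<le> 1 / D\<^sup>2 * freq_prod h powr (- (2 * lam))"
          using D T2 N par T weight_outside_index_set[of h N T "\<beta> - lam" \<alpha>]
          by (intro v_le) (auto simp: I_def D_def d_def)
      qed
      also have "\<dots> \<le> (\<Sum>\<^sub>\<infinity>h :: int ^ 'd. 1 / D\<^sup>2 * freq_prod h powr (- (2 * lam)))"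
        by (intro infsum_mono2 summable_on_cmult_right[OF sumS]
            summable_on_subset_banach[OF summable_on_cmult_right[OF sumS]]) auto
      also have "\<dots> = 1 / D\<^sup>2 * S" unfolding S_def by (rule infsum_cmult_right')
      also have "1 / D\<^sup>2 = (d powr (\<beta> - lam) * N powr (- (\<alpha> + \<beta> - lam)))\<^sup>2"
        unfolding D_def using d N by (simp add: power_mult_distrib powr_minus powr_diff powr_add field_simps)
      finally show ?thesis .
    qed
    have coeff: "fourier_coeff err k = fourier_coeff f k - (if k \<in> I then multi_coeff L z m I f k else 0)" for k
      unfolding err_def by (rule sampling_error_coeff(2)[OF fc finI])
    have errc: "err \<in> torus_continuous" unfolding err_def by (rule sampling_error_coeff(1)[OF fc finI])
    define q where "q = (\<lambda>k. (weight r t k)\<^sup>2 * (cmod (fourier_coeff err k))\<^sup>2)"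
    have out: "q k \<le> (a * E)\<^sup>2 * u k" if k: "k \<notin> I" for k
    proof -
      have "d powr (- (\<beta> - lam - t)) * N powr ((\<alpha> - r) + (\<beta> - lam - t)) \<le> weight (\<alpha> - r) (\<beta> - lam - t) k"
        unfolding d_def using k T1 N par T by (intro weight_outside_index_set[of k N T]) (auto simp: I_def)
      hence "1 \<le> a * E * weight (\<alpha> - r) (\<beta> - lam - t) k"
        using d N by (simp add: a_def E_def \<gamma>_def powr_minus powr_diff powr_add field_simps)
      also have "\<dots> \<le> a * E * weight (\<alpha> - r) (\<beta> - t) k"
        using a E par freq_prod_ge_1[of k] unfolding weight_eq by (intro mult_left_mono powr_mono) auto
      finally have "1 * weight r t k \<le> a * E * weight (\<alpha> - r) (\<beta> - t) k * weight r t k"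
        using weight_pos[of r t k] by (intro mult_right_mono) auto
      also have "\<dots> = a * E * w k" using weight_add[of "\<alpha> - r" r "\<beta> - t" t k] by (simp add: w_def)
      finally have "(weight r t k)\<^sup>2 \<le> (a * E * w k)\<^sup>2"
        using weight_pos[of r t k] by (intro power_mono) auto
      hence "q k \<le> (a * E * w k)\<^sup>2 * (cmod (fourier_coeff f k))\<^sup>2"
        using k by (simp add: q_def coeff mult_right_mono)
      thus ?thesis by (simp add: u_def power_mult_distrib mult_ac)
    qed
    have inside: "sum q I \<le> (b * E)\<^sup>2 * S * real L * infsum u UNIV"
    proof -
      define W where "W = d powr ((r + real_of_ereal T * t) / (1 - real_of_ereal T)) * N powr (r + t)"
      have "q k \<le> W\<^sup>2 * (cmod (multi_coeff L z m I f k - fourier_coeff f k))\<^sup>2" if k: "k \<in> I" for k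
      proof -
        have "weight r t k \<le> W"
          unfolding W_def d_def using k T1 N par T by (intro weight_inside_index_set) (auto simp: I_def)
        hence "(weight r t k)\<^sup>2 \<le> W\<^sup>2" using weight_pos[of r t k] by (intro power_mono) auto
        thus ?thesis using k by (simp add: q_def coeff norm_minus_commute mult_right_mono)
      qed
      hence "sum q I \<le> W\<^sup>2 * (\<Sum>k\<in>I. (cmod (multi_coeff L z m I f k - fourier_coeff f k))\<^sup>2)"
        unfolding sum_distrib_left by (rule sum_mono)
      also have "\<dots> \<le> W\<^sup>2 * (real L * (infsum v (-I) * infsum u UNIV))"
        unfolding u_def v_def using m rec u[unfolded u_def] v[unfolded v_def] w
        by (intro mult_left_mono multi_coeff_error_bound fc finI) (auto simp: I_def)
      also have "\<dots> \<le> W\<^sup>2 * (real L * ((d powr (\<beta> - lam) * N powr (- (\<alpha> + \<beta> - lam)))\<^sup>2 * S * infsum u UNIV))"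
        using V u0 by (intro mult_left_mono mult_right_mono) auto
      also have "\<dots> = (W * d powr (\<beta> - lam) * N powr (- (\<alpha> + \<beta> - lam)))\<^sup>2 * S * real L * infsum u UNIV"
        by (simp add: power_mult_distrib mult_ac)
      also have "W * d powr (\<beta> - lam) * N powr (- (\<alpha> + \<beta> - lam)) = b * E"
      proof -
        have "N powr (r + t) * N powr (- (\<alpha> + \<beta> - lam)) = E"
          unfolding powr_add[symmetric] E_def \<gamma>_def by (simp add: algebra_simps)
        thus ?thesis by (simp add: W_def b_def mult_ac)
      qed
      finally show ?thesis .
    qed
    have cu: "(\<lambda>k. (a * E)\<^sup>2 * u k) summable_on B" for B
      using summable_on_cmult_right[OF u] by (rule summable_on_subset_banach) simp
    have qsum: "q summable_on -I"
      by (rule summable_on_comparison_test[OF cu]) (use out in \<open>auto simp: q_def\<close>)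
    have qU: "q summable_on UNIV"
      using summable_on_Un_disjoint[OF qsum, of I] finI by (simp add: Un_commute)
    show "(\<lambda>x. f x - sampling_operator L z m (index_set N T) f x) \<in> hspace r t"
      unfolding I_def[symmetric] err_def[symmetric] hspace_def
      using errc qU set_integrable_unit_cube by (auto simp: torus_continuous_def q_def)
    have "infsum q UNIV = infsum q (-I) + infsum q I"
      using infsum_Un_disjoint[OF qsum, of I] finI by (simp add: Un_commute)
    also have "infsum q (-I) \<le> (\<Sum>\<^sub>\<infinity>k\<in>-I. (a * E)\<^sup>2 * u k)"
      using out by (intro infsum_mono qsum cu) auto
    also have "\<dots> \<le> (\<Sum>\<^sub>\<infinity>k. (a * E)\<^sup>2 * u k)"
      by (intro infsum_mono2 cu) (auto simp: u_def)
    also have "\<dots> = (a * E)\<^sup>2 * infsum u UNIV" by (rule infsum_cmult_right')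
    also have "\<dots> \<le> (a * E)\<^sup>2 * infsum u UNIV * (real L)\<^sup>2"
      using L u0 mult_left_mono[of 1 "(real L)\<^sup>2" "(a * E)\<^sup>2 * infsum u UNIV"] by simp
    also have "infsum q I \<le> (b * E)\<^sup>2 * S * real L * infsum u UNIV" using inside finI by simp
    also have "\<dots> \<le> (b * E)\<^sup>2 * S * (real L)\<^sup>2 * infsum u UNIV"
      using L u0 S by (intro mult_right_mono mult_left_mono) (auto simp: power2_eq_square)
    finally have "infsum q UNIV \<le> K * (E * real L)\<^sup>2 * infsum u UNIV"
      by (simp add: K_def power_mult_distrib algebra_simps)
    hence "hnorm r t err \<le> sqrt (K * (E * real L)\<^sup>2 * infsum u UNIV)"
      unfolding hnorm_def q_def[symmetric] by (rule real_sqrt_le_mono)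
    also have "\<dots> = sqrt K * E * real L * hnorm \<alpha> \<beta> f"
      using E by (simp add: hnorm_def u_def w_def real_sqrt_mult)
    finally show "hnorm r t (\<lambda>x. f x - sampling_operator L z m (index_set N T) f x)
       \<le> sqrt K * N powr (- (\<alpha> - r + \<beta> - t - lam)) * real L * hnorm \<alpha> \<beta> f"
      by (simp add: err_def I_def E_def \<gamma>_def)
  qed
qed

section \<open>The sampling error\<close>

theorem corollary3p6:
  fixes \<alpha> \<beta> lam r t C\<^sub>L C\<^sub>M :: real and T :: ereal
  assumes "lam > 1/2" and "\<beta> \<ge> lam"
    and "t \<ge> 0" and "\<beta> - lam \<ge> t"
    and "r + t \<ge> 0" and "\<alpha> + \<beta> - lam > r + t"
    and "T \<ge> neg_quot r t"
    and "T \<le> min (neg_quot \<alpha> (\<beta> - lam)) (neg_quot (\<alpha> - r) (\<beta> - lam - t))"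
    and "C\<^sub>L > 0" and "C\<^sub>M > 0"
  shows "\<exists>C>0. \<forall>(N::real) (f :: real ^ 'd \<Rightarrow> complex) (L::nat) (z :: nat \<Rightarrow> int ^ 'd) (m :: nat \<Rightarrow> nat).
    let I = index_set N T;
        M = real (\<Sum>l=1..L. m l);
        d = real CARD('d);
        err = (\<lambda>x. f x - sampling_operator L z m I f x)
    in N \<ge> 1 \<longrightarrow>
       f \<in> hspace \<alpha> \<beta> \<inter> torus_continuous \<longrightarrow>
       L \<ge> 1 \<longrightarrow> (\<forall>l\<in>{1..L}. m l \<ge> 1) \<longrightarrow>
       reconstruction_property L z m I \<longrightarrow>
       real L \<le> C\<^sub>L * ln (real (card I)) \<longrightarrow>
       M \<le> C\<^sub>M * (real (card I) * ln (real (card I))) \<longrightarrow>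
       err \<in> hspace r t \<and>
       hnorm r t err \<le> C * (N powr (- (\<alpha> - r + \<beta> - t - lam)) * ln (max 2 N) * hnorm \<alpha> \<beta> f) \<and>
       hnorm r t err \<le> C * (hnorm \<alpha> \<beta> f * ln M *
         (if T = -\<infinity> then (ln M / M) powr ((\<alpha> - r + \<beta> - lam) / d)
          else if T < 0 then
            (ln M / M) powr ((real_of_ereal T / d - 1) / (real_of_ereal T - 1) * (\<alpha> - r + \<beta> - t - lam))
          else if T = 0 then (ln M ^ CARD('d) / M) powr (\<alpha> - r + \<beta> - t - lam)
          else (ln M / M) powr (\<alpha> - r + \<beta> - t - lam)))"
proof -
  define \<gamma> where "\<gamma> = \<alpha> - r + \<beta> - t - lam"
  have \<gamma>: "\<gamma> \<ge> 0" using assms by (simp add: \<gamma>_def)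
  have T: "T \<le> neg_quot \<alpha> (\<beta> - lam)" "T \<le> neg_quot (\<alpha> - r) (\<beta> - lam - t)" using assms by auto
  have T1: "T < 1" by (rule shape_less_1[OF T(1)]) (use assms in auto)
  \<comment> \<open>The exponent stated for \<open>T = -\<infinity>\<close> omits \<open>t\<close>, which is 0 in that case.\<close>
  have t0: "t = 0" if "T = -\<infinity>"
    using that assms by (auto simp: neg_quot_def split: if_splits)
  define rate where "rate = (\<lambda>M. if T = -\<infinity> then (ln M / M) powr (\<gamma> / real CARD('d))
       else if T < 0 then (ln M / M) powr ((real_of_ereal T / real CARD('d) - 1) / (real_of_ereal T - 1) * \<gamma>)
       else if T = 0 then (ln M ^ CARD('d) / M) powr \<gamma>
       else (ln M / M) powr \<gamma>)"
  have rate0: "rate M \<ge> 0" for M by (simp add: rate_def)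
  have rate_eq: "(if T = -\<infinity> then (ln M / M) powr ((\<alpha> - r + \<beta> - lam) / real CARD('d))
          else if T < 0 then
            (ln M / M) powr ((real_of_ereal T / real CARD('d) - 1) / (real_of_ereal T - 1) * (\<alpha> - r + \<beta> - t - lam))
          else if T = 0 then (ln M ^ CARD('d) / M) powr (\<alpha> - r + \<beta> - t - lam)
          else (ln M / M) powr (\<alpha> - r + \<beta> - t - lam)) = rate M" for M
    using t0 by (simp add: rate_def \<gamma>_def)
  obtain K where K: "K > 0" and err: "\<And>N (f :: real ^ 'd \<Rightarrow> complex) L z m.
     N \<ge> 1 \<Longrightarrow> f \<in> hspace \<alpha> \<beta> \<inter> torus_continuous \<Longrightarrow> L \<ge> 1 \<Longrightarrow> (\<forall>l\<in>{1..L}. m l \<ge> 1) \<Longrightarrow>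
     reconstruction_property L z m (index_set N T) \<Longrightarrow>
     (\<lambda>x. f x - sampling_operator L z m (index_set N T) f x) \<in> hspace r t \<and>
     hnorm r t (\<lambda>x. f x - sampling_operator L z m (index_set N T) f x)
       \<le> K * N powr (- \<gamma>) * real L * hnorm \<alpha> \<beta> f"
    using sampling_error_bound[OF assms(1-7) T, where 'd='d] unfolding \<gamma>_def by blast
  obtain B where B: "B > 0" "\<And>N. N \<ge> 1 \<Longrightarrow> ln (real (card (index_set N T :: (int ^ 'd) set))) \<le> B * ln (max 2 N)"
    using ln_card_index_set[OF T1, where 'd='d] by blast
  obtain D where D: "D > 0" "\<And>N M. N \<ge> 1 \<Longrightarrow> real (card (index_set N T :: (int ^ 'd) set)) \<le> M \<Longrightarrow>
    M \<le> C\<^sub>M * (real (card (index_set N T :: (int ^ 'd) set)) * ln (real (card (index_set N T :: (int ^ 'd) set)))) \<Longrightarrow>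
    N powr (- \<gamma>) \<le> D * rate M"
    using rate_in_samples[OF T1 \<gamma> \<open>C\<^sub>M > 0\<close>, where 'd='d] unfolding rate_def by blast
  define C1 where "C1 = K * C\<^sub>L * B"
  define C where "C = C1 * (1 + D)"
  have C1: "C1 > 0" using K B assms by (simp add: C1_def)
  have C: "C > 0" "C1 \<le> C" "C1 * D \<le> C" using C1 D(1) by (auto simp: C_def algebra_simps intro!: add_pos_pos)
  show ?thesis
    unfolding Let_def rate_eq
  proof (intro exI[of _ C] conjI allI impI)
    show "C > 0" by (rule C)
    fix N :: real and f :: "real ^ 'd \<Rightarrow> complex" and L :: nat and z :: "nat \<Rightarrow> int ^ 'd" and m :: "nat \<Rightarrow> nat"
    define I where "I = (index_set N T :: (int ^ 'd) set)"
    define M where "M = real (\<Sum>l=1..L. m l)"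
    define e where "e = (\<lambda>x. f x - sampling_operator L z m (index_set N T) f x)"
    assume N: "N \<ge> 1" and f: "f \<in> hspace \<alpha> \<beta> \<inter> torus_continuous" and L: "L \<ge> 1"
      and m: "\<forall>l\<in>{1..L}. m l \<ge> 1" and rec: "reconstruction_property L z m (index_set N T)"
      and Lb: "real L \<le> C\<^sub>L * ln (real (card (index_set N T :: (int ^ 'd) set)))"
      and Mb: "real (\<Sum>l=1..L. m l) \<le> C\<^sub>M * (real (card (index_set N T :: (int ^ 'd) set)) * ln (real (card (index_set N T :: (int ^ 'd) set))))"
    let ?l = "ln (max 2 N)" and ?h = "hnorm \<alpha> \<beta> f"
    have h: "?h \<ge> 0" unfolding hnorm_def by (intro real_sqrt_ge_zero infsum_nonneg) auto
    have l: "?l \<ge> 0" by simp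
    show "(\<lambda>x. f x - sampling_operator L z m (index_set N T) f x) \<in> hspace r t"
      using err[OF N f L m rec] by blast
    have "hnorm r t e \<le> K * N powr (- \<gamma>) * real L * ?h"
      unfolding e_def using err[OF N f L m rec] by blast
    also have "\<dots> \<le> K * N powr (- \<gamma>) * (C\<^sub>L * (B * ?l)) * ?h"
    proof -
      have "real L \<le> C\<^sub>L * (B * ?l)"
        using Lb B(2)[OF N] \<open>C\<^sub>L > 0\<close> by (meson mult_left_mono less_imp_le order_trans)
      thus ?thesis using K h by (intro mult_right_mono mult_left_mono) auto
    qed
    finally have main: "hnorm r t e \<le> C1 * (N powr (- \<gamma>) * ?l * ?h)" by (simp add: C1_def mult_ac)
    also have "\<dots> \<le> C * (N powr (- \<gamma>) * ?l * ?h)"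
      using C h l by (intro mult_right_mono mult_nonneg_nonneg) auto
    finally show "hnorm r t (\<lambda>x. f x - sampling_operator L z m (index_set N T) f x)
        \<le> C * (N powr (- (\<alpha> - r + \<beta> - t - lam)) * ?l * ?h)"
      by (simp add: e_def \<gamma>_def)
    have "card I \<le> (\<Sum>l=1..L. m l)" unfolding I_def by (rule reconstruction_card_le[OF rec m])
    hence cM: "real (card I) \<le> M" unfolding M_def by (rule of_nat_mono)
    have "max 3 N \<le> M" using card_index_set_lower[OF N T1, where 'd='d] cM by (simp add: I_def)
    hence lM: "?l \<le> ln M" using N by (subst ln_le_cancel_iff) auto
    have rM: "N powr (- \<gamma>) \<le> D * rate M"
      using D(2)[OF N cM[unfolded I_def]] Mb by (simp add: M_def)
    note main
    also have "C1 * (N powr (- \<gamma>) * ?l * ?h) \<le> C1 * (D * rate M * ln M * ?h)"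
      using C1 h l lM rM D(1) rate0[of M] by (intro mult_left_mono mult_right_mono mult_mono) auto
    also have "\<dots> = C1 * D * (?h * ln M * rate M)" by (simp add: mult_ac)
    also have "\<dots> \<le> C * (?h * ln M * rate M)"
      using C h order_trans[OF l lM] rate0[of M] by (intro mult_right_mono mult_nonneg_nonneg) auto
    finally show "hnorm r t (\<lambda>x. f x - sampling_operator L z m (index_set N T) f x)
        \<le> C * (?h * ln (real (\<Sum>l=1..L. m l)) * rate (real (\<Sum>l=1..L. m l)))"
      by (simp add: e_def M_def)
  qed
qed

end
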